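(* Bisimulation equivalence $\leftrightarrow$ (defined in the context) is a congruence: for all closed process terms $p,q,p',q'$, all closed conditions $\phi$, all $H\subseteq A$ and all evaluation maps $\sigma$, if $p\leftrightarrow p'$ and $q\leftrightarrow q'$ then $p+q\leftrightarrow p'+q'$, $p\cdot q\leftrightarrow p'\cdot q'$, $p^*q\leftrightarrow p'^*q'$, $\phi:\to p\leftrightarrow\phi:\to p'$, $p\parallel q\leftrightarrow p'\parallel q'$, $p\lfloor\!\lfloor q\leftrightarrow p'\lfloor\!\lfloor q'$, $p\mid q\leftrightarrow p'\mid q'$, $\partial_H(p)\leftrightarrow\partial_H(p')$ and $V_\sigma(p)\leftrightarrow V_\sigma(p')$.
   Context: Setting. Fix a finite set $A$ of basic actions with $\delta,\epsilon\notin A$, and a commutative, associative function $\gamma:(A\cup\{\delta\})\times(A\cup\{\delta\})\to A\cup\{\delta\}$ with $\gamma(\delta,a)=\delta$ for all $a$. Fix a signature $\Sigma_D$ containing a sort $D$ of data, a minimal algebra $\mathfrak D$ of $\Sigma_D$, and a countably infinite set $\mathcal V$ of flexible variables. $\mathrm{DataVal}$ is the set of closed $\Sigma_D$-terms of sort $D$. There are sorts $P$ (processes), $C$ (conditions), $D$ (data), with logical variables of each sort. Terms of sort $D$: built from $\Sigma_D$, logical data variables, and a constant $v$ for each $v\in\mathcal V$. Terms of sort $C$: $e=e'$, $\mathsf{true}$, $\mathsf{false}$, $\neg,\wedge,\vee,\to$, $\forall X$, $\exists X$ ($X$ a logical data variable); $\phi\leftrightarrow\psi$ abbreviates $(\phi\to\psi)\wedge(\psi\to\phi)$.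 Terms of sort $P$: $\delta$, $\epsilon$, $a$ ($a\in A$); binary $+$, $\cdot$, $x^*y$ (iteration), $\parallel$, $\lfloor\!\lfloor$ (left merge), $\mid$ (communication merge); $\partial_H$ ($H\subseteq A$); guarded command $\phi:\to p$; data parameterized actions $a(e_1,\dots,e_n)$ ($a\in A$, $n\in\mathbb N$); assignment actions $v:=e$ ($v\in\mathcal V$); evaluation operators $V_\sigma$ for each evaluation map $\sigma$. An evaluation map is $\sigma:\mathcal V\to\mathrm{DataVal}\cup\mathcal V$ with $\sigma(v)=v$ whenever $\sigma(v)\in\mathcal V$; it is extended homomorphically to data and condition terms; $\sigma[e/v]$ is $\sigma$ updated to map $v$ to $e$. Closed terms contain no logical variables (flexible variables may occur). A closed condition is read as a first-order formula over $\mathfrak D$ with flexible variables as free data variables; $\mathfrak D\models\phi$ means it is valid in $\mathfrak D$. Let $\mathcal C^{s}$ be the set of closed conditions $\phi$ with $\mathfrak D\not\models\phi\leftrightarrow\mathsf{false}$. An action is a closed term $a$, $a(e_1,\dots,e_n)$ or $v:=e$ ($a\in A$, $e,e_i$ closed data terms). Operational semantics. For $\phi\in\mathcal C^s$, $p\downarrow_\phi$ (termination under $\phi$), and for $\phi\in\mathcal C^s$ and an action $\alpha$, $p\xrightarrow{[\phi]\alpha}q$, on closed process terms, defined as the least relations closed under the following rules ($a,b,c\in A$; "(s)" means the rule applies only if the resulting condition is not equivalent in $\mathfrak D$ to $\mathsf{false}$): $\epsilon\downarrow_{\mathsf{true}}$; $\alpha\xrightarrow{[\mathsf{true}]\alpha}\epsilon$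 for each action $\alpha$; if $x\downarrow_\phi$ then $x+y\downarrow_\phi$ and $y+x\downarrow_\phi$; if $x\xrightarrow{[\phi]\alpha}x'$ then $x+y$ and $y+x$ $\xrightarrow{[\phi]\alpha}x'$; if $x\downarrow_\phi,y\downarrow_\psi$ then $x\cdot y\downarrow_{\phi\wedge\psi}$ (s); if $x\downarrow_\phi$, $y\xrightarrow{[\psi]\alpha}y'$ then $x\cdot y\xrightarrow{[\phi\wedge\psi]\alpha}y'$ (s); if $x\xrightarrow{[\phi]\alpha}x'$ then $x\cdot y\xrightarrow{[\phi]\alpha}x'\cdot y$; if $y\downarrow_\phi$ then $x^*y\downarrow_\phi$; if $y\xrightarrow{[\phi]\alpha}y'$ then $x^*y\xrightarrow{[\phi]\alpha}y'$; if $x\xrightarrow{[\phi]\alpha}x'$ then $x^*y\xrightarrow{[\phi]\alpha}x'\cdot(x^*y)$; if $x\downarrow_\phi$ then $\psi:\to x\downarrow_{\phi\wedge\psi}$ (s); if $x\xrightarrow{[\phi]\alpha}x'$ then $\psi:\to x\xrightarrow{[\phi\wedge\psi]\alpha}x'$ (s); if $x\downarrow_\phi,y\downarrow_\psi$ then $x\parallel y\downarrow_{\phi\wedge\psi}$ (s); if $x\xrightarrow{[\phi]\alpha}x'$ then $x\parallel y\xrightarrow{[\phi]\alpha}x'\parallel y$; if $y\xrightarrow{[\phi]\alpha}y'$ then $x\parallel y\xrightarrow{[\phi]\alpha}x\parallel y'$; if $x\xrightarrow{[\phi]a}x'$, $y\xrightarrow{[\psi]b}y'$, $\gamma(a,b)=c$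 then $x\parallel y\xrightarrow{[\phi\wedge\psi]c}x'\parallel y'$ and $x\mid y\xrightarrow{[\phi\wedge\psi]c}x'\parallel y'$ (s); if $x\xrightarrow{[\phi]a(e_1,\dots,e_n)}x'$, $y\xrightarrow{[\psi]b(e'_1,\dots,e'_n)}y'$, $\gamma(a,b)=c$ then $x\parallel y$ and $x\mid y$ $\xrightarrow{[\phi\wedge\psi\wedge e_1=e'_1\wedge\dots\wedge e_n=e'_n]c(e_1,\dots,e_n)}x'\parallel y'$ (s); if $x\xrightarrow{[\phi]\alpha}x'$ then $x\lfloor\!\lfloor y\xrightarrow{[\phi]\alpha}x'\parallel y$; if $x\downarrow_\phi$ then $\partial_H(x)\downarrow_\phi$; if $x\xrightarrow{[\phi]\alpha}x'$ with $\alpha$ of the form $a$ or $a(e_1,\dots,e_n)$ with $a\notin H$, or of the form $v:=e$, then $\partial_H(x)\xrightarrow{[\phi]\alpha}\partial_H(x')$; if $x\downarrow_\phi$ then $V_\sigma(x)\downarrow_{\sigma(\phi)}$; if $x\xrightarrow{[\phi]a}x'$ then $V_\sigma(x)\xrightarrow{[\sigma(\phi)]a}V_\sigma(x')$; if $x\xrightarrow{[\phi]a(e_1,\dots,e_n)}x'$ then $V_\sigma(x)\xrightarrow{[\sigma(\phi)]a(\sigma(e_1),\dots,\sigma(e_n))}V_\sigma(x')$; if $x\xrightarrow{[\phi]v:=e}x'$ then $V_\sigma(x)\xrightarrow{[\sigma(\phi)]v:=\sigma(e)}V_{\sigma[\sigma(e)/v]}(x')$ if $\sigma(v)\in\mathrm{DataVal}$,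 and $V_\sigma(x)\xrightarrow{[\sigma(\phi)]v:=\sigma(e)}V_\sigma(x')$ if $\sigma(v)\notin\mathrm{DataVal}$. Bisimulation. Actions $\alpha,\alpha'$ are data equivalent ($\alpha\simeq\alpha'$) iff $\alpha=\alpha'=a$ for some $a\in A$, or $\alpha=a(e_1,\dots,e_n)$, $\alpha'=a(e'_1,\dots,e'_n)$ with $\mathfrak D\models e_1=e'_1\wedge\dots\wedge e_n=e'_n$, or $\alpha=(v:=e)$, $\alpha'=(v:=e')$ with $\mathfrak D\models e=e'$; $[\alpha]$ is the class of $\alpha$. A bisimulation is a relation $R$ on closed process terms such that for all $(p,q)\in R$: if $p\xrightarrow{[\phi]\alpha}p'$ then there is a finite $\Psi\subseteq\mathcal C^s$ with $\mathfrak D\models\phi\to\bigvee\Psi$ such that for each $\psi\in\Psi$ there are $\alpha'\in[\alpha]$ and $q'$ with $q\xrightarrow{[\psi]\alpha'}q'$ and $(p',q')\in R$; symmetrically for transitions of $q$; if $p\downarrow_\phi$ then there is a finite $\Psi\subseteq\mathcal C^s$ with $\mathfrak D\models\phi\to\bigvee\Psi$ and $q\downarrow_\psi$ for all $\psi\in\Psi$; symmetrically for $q$. $p\leftrightarrow q$ iff some bisimulation contains $(p,q)$.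
   Formalization: The update σ[σ(e)/v] need not be an evaluation map, so the assignment rule for V_σ is ill-defined; states may also use maps sending each v to itself or to a closed term over fixed variables, and the test σ(v)∈DataVal becomes σ(v)≠v (equivalent for evaluation maps). *)

theory Defs
  imports Main "HOL-Library.Countable"
begin

record ('s, 'f) data_sig =
  arg_sorts :: "'f \<Rightarrow> 's list"
  res_sort :: "'f \<Rightarrow> 's"
  dsort :: 's

record ('s, 'f, 'u) data_algebra = "('s, 'f) data_sig" +
  carr :: "'s \<Rightarrow> 'u set"
  interp :: "'f \<Rightarrow> 'u list \<Rightarrow> 'u"

definition op_closed :: "('s, 'f, 'u) data_algebra \<Rightarrow> ('s \<Rightarrow> 'u set) \<Rightarrow> bool" where
  "op_closed \<DD> C \<longleftrightarrow>
     (\<forall>f us. list_all2 (\<lambda>u s. u \<in> C s) us (arg_sorts \<DD> f) \<longrightarrow> interp \<DD> f us \<in> C (res_sort \<DD> f))"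

text \<open>An algebra is minimal iff it has no proper subalgebra.\<close>

definition minimal_algebra :: "('s, 'f, 'u) data_algebra \<Rightarrow> bool" where
  "minimal_algebra \<DD> \<longleftrightarrow>
     op_closed \<DD> (carr \<DD>) \<and>
     (\<forall>C. (\<forall>s. C s \<subseteq> carr \<DD> s) \<and> op_closed \<DD> C \<longrightarrow> C = carr \<DD>)"

text \<open>Logical data variables are named by natural numbers. Logical variables of the sorts of
  processes and conditions never occur in closed terms (quantifiers bind data variables only)
  and are omitted.\<close>

datatype ('f, 'v) dterm =
    Op 'f "('f, 'v) dterm list"
  | LVar nat
  | FVar 'v

datatype ('f, 'v) cond =
    CEq "('f, 'v) dterm" "('f, 'v) dterm"
  | CTrue
  | CFalse
  | CNot "('f, 'v) cond"
  | CAnd "('f, 'v) cond" "('f, 'v) cond"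
  | COr "('f, 'v) cond" "('f, 'v) cond"
  | CImp "('f, 'v) cond" "('f, 'v) cond"
  | CAll nat "('f, 'v) cond"
  | CEx nat "('f, 'v) cond"

abbreviation CIff :: "('f, 'v) cond \<Rightarrow> ('f, 'v) cond \<Rightarrow> ('f, 'v) cond" where
  "CIff \<phi> \<psi> \<equiv> CAnd (CImp \<phi> \<psi>) (CImp \<psi> \<phi>)"

datatype ('a, 'f, 'v) action =
    Basic 'a
  | Param 'a "('f, 'v) dterm list"
  | Assign 'v "('f, 'v) dterm"

datatype ('a, 'f, 'v) proc =
    Delta
  | Eps
  | Act "('a, 'f, 'v) action"
  | Alt "('a, 'f, 'v) proc" "('a, 'f, 'v) proc"
  | Seq "('a, 'f, 'v) proc" "('a, 'f, 'v) proc"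
  | Iter "('a, 'f, 'v) proc" "('a, 'f, 'v) proc"
  | Par "('a, 'f, 'v) proc" "('a, 'f, 'v) proc"
  | LMerge "('a, 'f, 'v) proc" "('a, 'f, 'v) proc"
  | CMerge "('a, 'f, 'v) proc" "('a, 'f, 'v) proc"
  | Encap "'a set" "('a, 'f, 'v) proc"
  | Guard "('f, 'v) cond" "('a, 'f, 'v) proc"
  | Eval "'v \<Rightarrow> ('f, 'v) dterm" "('a, 'f, 'v) proc"

primrec sort_of :: "('s, 'f, 'z) data_sig_scheme \<Rightarrow> ('f, 'v) dterm \<Rightarrow> 's" where
  "sort_of S (Op f ts) = res_sort S f"
| "sort_of S (LVar X) = dsort S"
| "sort_of S (FVar v) = dsort S"

primrec well_sorted :: "('s, 'f, 'z) data_sig_scheme \<Rightarrow> ('f, 'v) dterm \<Rightarrow> bool" where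
  "well_sorted S (Op f ts) \<longleftrightarrow> list_all (\<lambda>b. b) (map (well_sorted S) ts) \<and> map (sort_of S) ts = arg_sorts S f"
| "well_sorted S (LVar X) \<longleftrightarrow> True"
| "well_sorted S (FVar v) \<longleftrightarrow> True"

primrec lvars :: "('f, 'v) dterm \<Rightarrow> nat set" where
  "lvars (Op f ts) = \<Union> (set (map lvars ts))"
| "lvars (LVar X) = {X}"
| "lvars (FVar v) = {}"

primrec fvars :: "('f, 'v) dterm \<Rightarrow> 'v set" where
  "fvars (Op f ts) = \<Union> (set (map fvars ts))"
| "fvars (LVar X) = {}"
| "fvars (FVar v) = {v}"

definition closed_data :: "('s, 'f, 'z) data_sig_scheme \<Rightarrow> ('f, 'v) dterm \<Rightarrow> bool" where
  "closed_data S e \<longleftrightarrow> well_sorted S e \<and> sort_of S e = dsort S \<and> lvars e = {}"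

definition DataVal :: "('s, 'f, 'z) data_sig_scheme \<Rightarrow> ('f, 'v) dterm set" where
  "DataVal S = {e. closed_data S e \<and> fvars e = {}}"

primrec well_formed_cond :: "('s, 'f, 'z) data_sig_scheme \<Rightarrow> ('f, 'v) cond \<Rightarrow> bool" where
  "well_formed_cond S (CEq e e') \<longleftrightarrow>
     well_sorted S e \<and> sort_of S e = dsort S \<and> well_sorted S e' \<and> sort_of S e' = dsort S"
| "well_formed_cond S CTrue \<longleftrightarrow> True"
| "well_formed_cond S CFalse \<longleftrightarrow> True"
| "well_formed_cond S (CNot \<phi>) \<longleftrightarrow> well_formed_cond S \<phi>"
| "well_formed_cond S (CAnd \<phi> \<psi>) \<longleftrightarrow> well_formed_cond S \<phi> \<and> well_formed_cond S \<psi>"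
| "well_formed_cond S (COr \<phi> \<psi>) \<longleftrightarrow> well_formed_cond S \<phi> \<and> well_formed_cond S \<psi>"
| "well_formed_cond S (CImp \<phi> \<psi>) \<longleftrightarrow> well_formed_cond S \<phi> \<and> well_formed_cond S \<psi>"
| "well_formed_cond S (CAll X \<phi>) \<longleftrightarrow> well_formed_cond S \<phi>"
| "well_formed_cond S (CEx X \<phi>) \<longleftrightarrow> well_formed_cond S \<phi>"

primrec free_lvars :: "('f, 'v) cond \<Rightarrow> nat set" where
  "free_lvars (CEq e e') = lvars e \<union> lvars e'"
| "free_lvars CTrue = {}"
| "free_lvars CFalse = {}"
| "free_lvars (CNot \<phi>) = free_lvars \<phi>"
| "free_lvars (CAnd \<phi> \<psi>) = free_lvars \<phi> \<union> free_lvars \<psi>"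
| "free_lvars (COr \<phi> \<psi>) = free_lvars \<phi> \<union> free_lvars \<psi>"
| "free_lvars (CImp \<phi> \<psi>) = free_lvars \<phi> \<union> free_lvars \<psi>"
| "free_lvars (CAll X \<phi>) = free_lvars \<phi> - {X}"
| "free_lvars (CEx X \<phi>) = free_lvars \<phi> - {X}"

definition closed_cond :: "('s, 'f, 'z) data_sig_scheme \<Rightarrow> ('f, 'v) cond \<Rightarrow> bool" where
  "closed_cond S \<phi> \<longleftrightarrow> well_formed_cond S \<phi> \<and> free_lvars \<phi> = {}"

primrec closed_action :: "('s, 'f, 'z) data_sig_scheme \<Rightarrow> ('a, 'f, 'v) action \<Rightarrow> bool" where
  "closed_action S (Basic a) \<longleftrightarrow> True"
| "closed_action S (Param a es) \<longleftrightarrow> (\<forall>e\<in>set es. closed_data S e)"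
| "closed_action S (Assign v e) \<longleftrightarrow> closed_data S e"

definition eval_map :: "('s, 'f, 'z) data_sig_scheme \<Rightarrow> ('v \<Rightarrow> ('f, 'v) dterm) \<Rightarrow> bool" where
  "eval_map S \<sigma> \<longleftrightarrow>
     (\<forall>v. \<sigma> v \<in> DataVal S \<union> range FVar) \<and> (\<forall>v. \<sigma> v \<in> range FVar \<longrightarrow> \<sigma> v = FVar v)"

text \<open>The update \<open>\<sigma>[\<sigma>(e)/v]\<close> in the transition rule for assignments can leave the set of
  evaluation maps: \<open>\<sigma>(v)\<close> may be a data value while \<open>\<sigma>(e)\<close> still contains flexible variables
  that \<open>\<sigma>\<close> leaves unevaluated. The maps below contain the evaluation maps and are closed under
  these updates. They index the evaluation operators that may occur in the states of the
  transition system; closed process terms use evaluation maps only.\<close>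

definition ext_eval_map :: "('s, 'f, 'z) data_sig_scheme \<Rightarrow> ('v \<Rightarrow> ('f, 'v) dterm) \<Rightarrow> bool" where
  "ext_eval_map S \<sigma> \<longleftrightarrow>
     (\<forall>v. \<sigma> v = FVar v \<or> closed_data S (\<sigma> v) \<and> (\<forall>w\<in>fvars (\<sigma> v). \<sigma> w = FVar w))"

text \<open>\<open>M\<close> is the set of maps admitted as indices of evaluation operators.\<close>

primrec closed_proc_over ::
  "('s, 'f, 'z) data_sig_scheme \<Rightarrow> ('v \<Rightarrow> ('f, 'v) dterm) set \<Rightarrow> ('a, 'f, 'v) proc \<Rightarrow> bool" where
  "closed_proc_over S M Delta \<longleftrightarrow> True"
| "closed_proc_over S M Eps \<longleftrightarrow> True"
| "closed_proc_over S M (Act \<alpha>) \<longleftrightarrow> closed_action S \<alpha>"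
| "closed_proc_over S M (Alt p q) \<longleftrightarrow> closed_proc_over S M p \<and> closed_proc_over S M q"
| "closed_proc_over S M (Seq p q) \<longleftrightarrow> closed_proc_over S M p \<and> closed_proc_over S M q"
| "closed_proc_over S M (Iter p q) \<longleftrightarrow> closed_proc_over S M p \<and> closed_proc_over S M q"
| "closed_proc_over S M (Par p q) \<longleftrightarrow> closed_proc_over S M p \<and> closed_proc_over S M q"
| "closed_proc_over S M (LMerge p q) \<longleftrightarrow> closed_proc_over S M p \<and> closed_proc_over S M q"
| "closed_proc_over S M (CMerge p q) \<longleftrightarrow> closed_proc_over S M p \<and> closed_proc_over S M q"
| "closed_proc_over S M (Encap H p) \<longleftrightarrow> closed_proc_over S M p"
| "closed_proc_over S M (Guard \<phi> p) \<longleftrightarrow> closed_cond S \<phi> \<and> closed_proc_over S M p"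
| "closed_proc_over S M (Eval \<sigma> p) \<longleftrightarrow> \<sigma> \<in> M \<and> closed_proc_over S M p"

definition closed_proc :: "('s, 'f, 'z) data_sig_scheme \<Rightarrow> ('a, 'f, 'v) proc \<Rightarrow> bool" where
  "closed_proc S = closed_proc_over S (Collect (eval_map S))"

definition proc_state :: "('s, 'f, 'z) data_sig_scheme \<Rightarrow> ('a, 'f, 'v) proc \<Rightarrow> bool" where
  "proc_state S = closed_proc_over S (Collect (ext_eval_map S))"

primrec dsubst :: "('v \<Rightarrow> ('f, 'v) dterm) \<Rightarrow> ('f, 'v) dterm \<Rightarrow> ('f, 'v) dterm" where
  "dsubst \<sigma> (Op f ts) = Op f (map (dsubst \<sigma>) ts)"
| "dsubst \<sigma> (LVar X) = LVar X"
| "dsubst \<sigma> (FVar v) = \<sigma> v"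

text \<open>Capture cannot occur below quantifiers: the terms \<open>\<sigma> v\<close> contain no logical variables.\<close>

primrec csubst :: "('v \<Rightarrow> ('f, 'v) dterm) \<Rightarrow> ('f, 'v) cond \<Rightarrow> ('f, 'v) cond" where
  "csubst \<sigma> (CEq e e') = CEq (dsubst \<sigma> e) (dsubst \<sigma> e')"
| "csubst \<sigma> CTrue = CTrue"
| "csubst \<sigma> CFalse = CFalse"
| "csubst \<sigma> (CNot \<phi>) = CNot (csubst \<sigma> \<phi>)"
| "csubst \<sigma> (CAnd \<phi> \<psi>) = CAnd (csubst \<sigma> \<phi>) (csubst \<sigma> \<psi>)"
| "csubst \<sigma> (COr \<phi> \<psi>) = COr (csubst \<sigma> \<phi>) (csubst \<sigma> \<psi>)"
| "csubst \<sigma> (CImp \<phi> \<psi>) = CImp (csubst \<sigma> \<phi>) (csubst \<sigma> \<psi>)"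
| "csubst \<sigma> (CAll X \<phi>) = CAll X (csubst \<sigma> \<phi>)"
| "csubst \<sigma> (CEx X \<phi>) = CEx X (csubst \<sigma> \<phi>)"

primrec dval ::
  "('s, 'f, 'u) data_algebra \<Rightarrow> ('v \<Rightarrow> 'u) \<Rightarrow> (nat \<Rightarrow> 'u) \<Rightarrow> ('f, 'v) dterm \<Rightarrow> 'u" where
  "dval \<DD> \<rho> \<theta> (Op f ts) = interp \<DD> f (map (dval \<DD> \<rho> \<theta>) ts)"
| "dval \<DD> \<rho> \<theta> (LVar X) = \<theta> X"
| "dval \<DD> \<rho> \<theta> (FVar v) = \<rho> v"

primrec sat ::
  "('s, 'f, 'u) data_algebra \<Rightarrow> ('v \<Rightarrow> 'u) \<Rightarrow> (nat \<Rightarrow> 'u) \<Rightarrow> ('f, 'v) cond \<Rightarrow> bool" where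
  "sat \<DD> \<rho> \<theta> (CEq e e') \<longleftrightarrow> dval \<DD> \<rho> \<theta> e = dval \<DD> \<rho> \<theta> e'"
| "sat \<DD> \<rho> \<theta> CTrue \<longleftrightarrow> True"
| "sat \<DD> \<rho> \<theta> CFalse \<longleftrightarrow> False"
| "sat \<DD> \<rho> \<theta> (CNot \<phi>) \<longleftrightarrow> \<not> sat \<DD> \<rho> \<theta> \<phi>"
| "sat \<DD> \<rho> \<theta> (CAnd \<phi> \<psi>) \<longleftrightarrow> sat \<DD> \<rho> \<theta> \<phi> \<and> sat \<DD> \<rho> \<theta> \<psi>"
| "sat \<DD> \<rho> \<theta> (COr \<phi> \<psi>) \<longleftrightarrow> sat \<DD> \<rho> \<theta> \<phi> \<or> sat \<DD> \<rho> \<theta> \<psi>"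
| "sat \<DD> \<rho> \<theta> (CImp \<phi> \<psi>) \<longleftrightarrow> (sat \<DD> \<rho> \<theta> \<phi> \<longrightarrow> sat \<DD> \<rho> \<theta> \<psi>)"
| "sat \<DD> \<rho> \<theta> (CAll X \<phi>) \<longleftrightarrow> (\<forall>u\<in>carr \<DD> (dsort \<DD>). sat \<DD> \<rho> (\<theta>(X := u)) \<phi>)"
| "sat \<DD> \<rho> \<theta> (CEx X \<phi>) \<longleftrightarrow> (\<exists>u\<in>carr \<DD> (dsort \<DD>). sat \<DD> \<rho> (\<theta>(X := u)) \<phi>)"

definition valid :: "('s, 'f, 'u) data_algebra \<Rightarrow> ('f, 'v) cond \<Rightarrow> bool" where
  "valid \<DD> \<phi> \<longleftrightarrow>
     (\<forall>\<rho> \<theta>. range \<rho> \<subseteq> carr \<DD> (dsort \<DD>) \<and> range \<theta> \<subseteq> carr \<DD> (dsort \<DD>) \<longrightarrow> sat \<DD> \<rho> \<theta> \<phi>)"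

definition Cs :: "('s, 'f, 'u) data_algebra \<Rightarrow> ('f, 'v) cond set" where
  "Cs \<DD> = {\<phi>. closed_cond \<DD> \<phi> \<and> \<not> valid \<DD> (CIff \<phi> CFalse)}"

definition big_disj :: "('f, 'v) cond set \<Rightarrow> ('f, 'v) cond" where
  "big_disj \<Psi> = foldr COr (SOME \<psi>s. set \<psi>s = \<Psi>) CFalse"

text \<open>\<open>\<chi> \<and> e\<^sub>1 = e'\<^sub>1 \<and> \<dots> \<and> e\<^sub>n = e'\<^sub>n\<close>, for lists of equal length\<close>

definition conj_eqs ::
  "('f, 'v) cond \<Rightarrow> ('f, 'v) dterm list \<Rightarrow> ('f, 'v) dterm list \<Rightarrow> ('f, 'v) cond" where
  "conj_eqs \<chi> es es' = foldl CAnd \<chi> (map2 CEq es es')"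

text \<open>\<open>None\<close> plays the role of \<open>\<delta>\<close>.\<close>

definition communication_function :: "('a option \<Rightarrow> 'a option \<Rightarrow> 'a option) \<Rightarrow> bool" where
  "communication_function \<gamma> \<longleftrightarrow>
     (\<forall>x y. \<gamma> x y = \<gamma> y x) \<and>
     (\<forall>x y z. \<gamma> (\<gamma> x y) z = \<gamma> x (\<gamma> y z)) \<and>
     (\<forall>x. \<gamma> None x = None)"

text \<open>Both relations are indexed by conditions in \<open>Cs\<close>, so the rules for evaluation operators,
  too, apply only if the resulting condition is in \<open>Cs\<close>.\<close>

inductive terminates ::
  "('s, 'f, 'u) data_algebra \<Rightarrow> ('a, 'f, 'v) proc \<Rightarrow> ('f, 'v) cond \<Rightarrow> bool"
  for \<DD> :: "('s, 'f, 'u) data_algebra" where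
  "terminates \<DD> Eps CTrue"
| "terminates \<DD> x \<phi> \<Longrightarrow> terminates \<DD> (Alt x y) \<phi>"
| "terminates \<DD> x \<phi> \<Longrightarrow> terminates \<DD> (Alt y x) \<phi>"
| "terminates \<DD> x \<phi> \<Longrightarrow> terminates \<DD> y \<psi> \<Longrightarrow> CAnd \<phi> \<psi> \<in> Cs \<DD> \<Longrightarrow>
     terminates \<DD> (Seq x y) (CAnd \<phi> \<psi>)"
| "terminates \<DD> y \<phi> \<Longrightarrow> terminates \<DD> (Iter x y) \<phi>"
| "terminates \<DD> x \<phi> \<Longrightarrow> CAnd \<phi> \<psi> \<in> Cs \<DD> \<Longrightarrow> terminates \<DD> (Guard \<psi> x) (CAnd \<phi> \<psi>)"
| "terminates \<DD> x \<phi> \<Longrightarrow> terminates \<DD> y \<psi> \<Longrightarrow> CAnd \<phi> \<psi> \<in> Cs \<DD> \<Longrightarrow>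
     terminates \<DD> (Par x y) (CAnd \<phi> \<psi>)"
| "terminates \<DD> x \<phi> \<Longrightarrow> terminates \<DD> (Encap H x) \<phi>"
| "terminates \<DD> x \<phi> \<Longrightarrow> csubst \<sigma> \<phi> \<in> Cs \<DD> \<Longrightarrow> terminates \<DD> (Eval \<sigma> x) (csubst \<sigma> \<phi>)"

text \<open>In the last two rules, \<open>\<sigma> v \<noteq> FVar v\<close> says that \<open>\<sigma>\<close> evaluates \<open>v\<close>. For evaluation maps this
  is equivalent to \<open>\<sigma> v \<in> DataVal\<close> (lemma \<open>eval_map_DataVal_iff\<close>). On the other maps that index
  states, testing for \<open>DataVal\<close> would make the effect of assignments depend on the syntactic
  form of earlier assigned terms and not only on their data equivalence class.\<close>

inductive step ::
  "('s, 'f, 'u) data_algebra \<Rightarrow> ('a option \<Rightarrow> 'a option \<Rightarrow> 'a option) \<Rightarrow>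
   ('a, 'f, 'v) proc \<Rightarrow> ('f, 'v) cond \<Rightarrow> ('a, 'f, 'v) action \<Rightarrow> ('a, 'f, 'v) proc \<Rightarrow> bool"
  for \<DD> :: "('s, 'f, 'u) data_algebra" and \<gamma> :: "'a option \<Rightarrow> 'a option \<Rightarrow> 'a option" where
  "step \<DD> \<gamma> (Act \<alpha>) CTrue \<alpha> Eps"
| "step \<DD> \<gamma> x \<phi> \<alpha> x' \<Longrightarrow> step \<DD> \<gamma> (Alt x y) \<phi> \<alpha> x'"
| "step \<DD> \<gamma> x \<phi> \<alpha> x' \<Longrightarrow> step \<DD> \<gamma> (Alt y x) \<phi> \<alpha> x'"
| "terminates \<DD> x \<phi> \<Longrightarrow> step \<DD> \<gamma> y \<psi> \<alpha> y' \<Longrightarrow> CAnd \<phi> \<psi> \<in> Cs \<DD> \<Longrightarrow>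
     step \<DD> \<gamma> (Seq x y) (CAnd \<phi> \<psi>) \<alpha> y'"
| "step \<DD> \<gamma> x \<phi> \<alpha> x' \<Longrightarrow> step \<DD> \<gamma> (Seq x y) \<phi> \<alpha> (Seq x' y)"
| "step \<DD> \<gamma> y \<phi> \<alpha> y' \<Longrightarrow> step \<DD> \<gamma> (Iter x y) \<phi> \<alpha> y'"
| "step \<DD> \<gamma> x \<phi> \<alpha> x' \<Longrightarrow> step \<DD> \<gamma> (Iter x y) \<phi> \<alpha> (Seq x' (Iter x y))"
| "step \<DD> \<gamma> x \<phi> \<alpha> x' \<Longrightarrow> CAnd \<phi> \<psi> \<in> Cs \<DD> \<Longrightarrow> step \<DD> \<gamma> (Guard \<psi> x) (CAnd \<phi> \<psi>) \<alpha> x'"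
| "step \<DD> \<gamma> x \<phi> \<alpha> x' \<Longrightarrow> step \<DD> \<gamma> (Par x y) \<phi> \<alpha> (Par x' y)"
| "step \<DD> \<gamma> y \<phi> \<alpha> y' \<Longrightarrow> step \<DD> \<gamma> (Par x y) \<phi> \<alpha> (Par x y')"
| "step \<DD> \<gamma> x \<phi> (Basic a) x' \<Longrightarrow> step \<DD> \<gamma> y \<psi> (Basic b) y' \<Longrightarrow>
     \<gamma> (Some a) (Some b) = Some c \<Longrightarrow> CAnd \<phi> \<psi> \<in> Cs \<DD> \<Longrightarrow>
     step \<DD> \<gamma> (Par x y) (CAnd \<phi> \<psi>) (Basic c) (Par x' y')"
| "step \<DD> \<gamma> x \<phi> (Basic a) x' \<Longrightarrow> step \<DD> \<gamma> y \<psi> (Basic b) y' \<Longrightarrow>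
     \<gamma> (Some a) (Some b) = Some c \<Longrightarrow> CAnd \<phi> \<psi> \<in> Cs \<DD> \<Longrightarrow>
     step \<DD> \<gamma> (CMerge x y) (CAnd \<phi> \<psi>) (Basic c) (Par x' y')"
| "step \<DD> \<gamma> x \<phi> (Param a es) x' \<Longrightarrow> step \<DD> \<gamma> y \<psi> (Param b es') y' \<Longrightarrow> length es = length es' \<Longrightarrow>
     \<gamma> (Some a) (Some b) = Some c \<Longrightarrow> conj_eqs (CAnd \<phi> \<psi>) es es' \<in> Cs \<DD> \<Longrightarrow>
     step \<DD> \<gamma> (Par x y) (conj_eqs (CAnd \<phi> \<psi>) es es') (Param c es) (Par x' y')"
| "step \<DD> \<gamma> x \<phi> (Param a es) x' \<Longrightarrow> step \<DD> \<gamma> y \<psi> (Param b es') y' \<Longrightarrow> length es = length es' \<Longrightarrow>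
     \<gamma> (Some a) (Some b) = Some c \<Longrightarrow> conj_eqs (CAnd \<phi> \<psi>) es es' \<in> Cs \<DD> \<Longrightarrow>
     step \<DD> \<gamma> (CMerge x y) (conj_eqs (CAnd \<phi> \<psi>) es es') (Param c es) (Par x' y')"
| "step \<DD> \<gamma> x \<phi> \<alpha> x' \<Longrightarrow> step \<DD> \<gamma> (LMerge x y) \<phi> \<alpha> (Par x' y)"
| "step \<DD> \<gamma> x \<phi> (Basic a) x' \<Longrightarrow> a \<notin> H \<Longrightarrow> step \<DD> \<gamma> (Encap H x) \<phi> (Basic a) (Encap H x')"
| "step \<DD> \<gamma> x \<phi> (Param a es) x' \<Longrightarrow> a \<notin> H \<Longrightarrow> step \<DD> \<gamma> (Encap H x) \<phi> (Param a es) (Encap H x')"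
| "step \<DD> \<gamma> x \<phi> (Assign v e) x' \<Longrightarrow> step \<DD> \<gamma> (Encap H x) \<phi> (Assign v e) (Encap H x')"
| "step \<DD> \<gamma> x \<phi> (Basic a) x' \<Longrightarrow> csubst \<sigma> \<phi> \<in> Cs \<DD> \<Longrightarrow>
     step \<DD> \<gamma> (Eval \<sigma> x) (csubst \<sigma> \<phi>) (Basic a) (Eval \<sigma> x')"
| "step \<DD> \<gamma> x \<phi> (Param a es) x' \<Longrightarrow> csubst \<sigma> \<phi> \<in> Cs \<DD> \<Longrightarrow>
     step \<DD> \<gamma> (Eval \<sigma> x) (csubst \<sigma> \<phi>) (Param a (map (dsubst \<sigma>) es)) (Eval \<sigma> x')"
| "step \<DD> \<gamma> x \<phi> (Assign v e) x' \<Longrightarrow> csubst \<sigma> \<phi> \<in> Cs \<DD> \<Longrightarrow> \<sigma> v \<noteq> FVar v \<Longrightarrow>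
     step \<DD> \<gamma> (Eval \<sigma> x) (csubst \<sigma> \<phi>) (Assign v (dsubst \<sigma> e)) (Eval (\<sigma>(v := dsubst \<sigma> e)) x')"
| "step \<DD> \<gamma> x \<phi> (Assign v e) x' \<Longrightarrow> csubst \<sigma> \<phi> \<in> Cs \<DD> \<Longrightarrow> \<sigma> v = FVar v \<Longrightarrow>
     step \<DD> \<gamma> (Eval \<sigma> x) (csubst \<sigma> \<phi>) (Assign v (dsubst \<sigma> e)) (Eval \<sigma> x')"

inductive data_equiv ::
  "('s, 'f, 'u) data_algebra \<Rightarrow> ('a, 'f, 'v) action \<Rightarrow> ('a, 'f, 'v) action \<Rightarrow> bool"
  for \<DD> :: "('s, 'f, 'u) data_algebra" where
  "data_equiv \<DD> (Basic a) (Basic a)"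
| "length es = length es' \<Longrightarrow> valid \<DD> (conj_eqs CTrue es es') \<Longrightarrow>
     data_equiv \<DD> (Param a es) (Param a es')"
| "valid \<DD> (CEq e e') \<Longrightarrow> data_equiv \<DD> (Assign v e) (Assign v e')"

definition bisimulation ::
  "('s, 'f, 'u) data_algebra \<Rightarrow> ('a option \<Rightarrow> 'a option \<Rightarrow> 'a option) \<Rightarrow>
   (('a, 'f, 'v) proc \<times> ('a, 'f, 'v) proc) set \<Rightarrow> bool" where
  "bisimulation \<DD> \<gamma> R \<longleftrightarrow>
     R \<subseteq> Collect (proc_state \<DD>) \<times> Collect (proc_state \<DD>) \<and>
     (\<forall>(p, q)\<in>R.
        (\<forall>\<phi> \<alpha> p'. step \<DD> \<gamma> p \<phi> \<alpha> p' \<longrightarrow>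
           (\<exists>\<Psi>. finite \<Psi> \<and> \<Psi> \<subseteq> Cs \<DD> \<and> valid \<DD> (CImp \<phi> (big_disj \<Psi>)) \<and>
              (\<forall>\<psi>\<in>\<Psi>. \<exists>\<alpha>' q'. data_equiv \<DD> \<alpha> \<alpha>' \<and> step \<DD> \<gamma> q \<psi> \<alpha>' q' \<and> (p', q') \<in> R))) \<and>
        (\<forall>\<phi> \<alpha> q'. step \<DD> \<gamma> q \<phi> \<alpha> q' \<longrightarrow>
           (\<exists>\<Psi>. finite \<Psi> \<and> \<Psi> \<subseteq> Cs \<DD> \<and> valid \<DD> (CImp \<phi> (big_disj \<Psi>)) \<and>
              (\<forall>\<psi>\<in>\<Psi>. \<exists>\<alpha>' p'. data_equiv \<DD> \<alpha> \<alpha>' \<and> step \<DD> \<gamma> p \<psi> \<alpha>' p' \<and> (p', q') \<in> R))) \<and>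
        (\<forall>\<phi>. terminates \<DD> p \<phi> \<longrightarrow>
           (\<exists>\<Psi>. finite \<Psi> \<and> \<Psi> \<subseteq> Cs \<DD> \<and> valid \<DD> (CImp \<phi> (big_disj \<Psi>)) \<and>
              (\<forall>\<psi>\<in>\<Psi>. terminates \<DD> q \<psi>))) \<and>
        (\<forall>\<phi>. terminates \<DD> q \<phi> \<longrightarrow>
           (\<exists>\<Psi>. finite \<Psi> \<and> \<Psi> \<subseteq> Cs \<DD> \<and> valid \<DD> (CImp \<phi> (big_disj \<Psi>)) \<and>
              (\<forall>\<psi>\<in>\<Psi>. terminates \<DD> p \<psi>))))"

definition bisimilar ::
  "('s, 'f, 'u) data_algebra \<Rightarrow> ('a option \<Rightarrow> 'a option \<Rightarrow> 'a option) \<Rightarrow>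
   ('a, 'f, 'v) proc \<Rightarrow> ('a, 'f, 'v) proc \<Rightarrow> bool" where
  "bisimilar \<DD> \<gamma> p q \<longleftrightarrow> (\<exists>R. bisimulation \<DD> \<gamma> R \<and> (p, q) \<in> R)"

lemma sat_big_disj:
  assumes "finite \<Psi>"
  shows "sat \<DD> \<rho> \<theta> (big_disj \<Psi>) \<longleftrightarrow> (\<exists>\<psi>\<in>\<Psi>. sat \<DD> \<rho> \<theta> \<psi>)"
proof -
  have "sat \<DD> \<rho> \<theta> (foldr COr \<psi>s CFalse) \<longleftrightarrow> (\<exists>\<psi>\<in>set \<psi>s. sat \<DD> \<rho> \<theta> \<psi>)" for \<psi>s
    by (induction \<psi>s) auto
  moreover have "set (SOME \<psi>s. set \<psi>s = \<Psi>) = \<Psi>"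
    using finite_list[OF assms] by (rule someI_ex)
  ultimately show ?thesis
    by (simp add: big_disj_def)
qed

lemma eval_map_DataVal_iff:
  assumes "eval_map S \<sigma>"
  shows "\<sigma> v \<in> DataVal S \<longleftrightarrow> \<sigma> v \<noteq> FVar v"
proof -
  have "FVar v \<notin> DataVal S"
    by (simp add: DataVal_def)
  with assms show ?thesis
    unfolding eval_map_def by (metis UnE)
qed

lemma eval_map_imp_ext_eval_map:
  assumes "eval_map S \<sigma>"
  shows "ext_eval_map S \<sigma>"
  unfolding ext_eval_map_def
proof
  fix v
  show "\<sigma> v = FVar v \<or> closed_data S (\<sigma> v) \<and> (\<forall>w\<in>fvars (\<sigma> v). \<sigma> w = FVar w)"
    using eval_map_DataVal_iff[OF assms, of v] by (auto simp: DataVal_def)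
qed

lemma eval_map_update:
  assumes "eval_map S \<sigma>" "e \<in> DataVal S"
  shows "eval_map S (\<sigma>(v := e))"
proof -
  have "e \<notin> range FVar"
    using assms(2) by (auto simp: DataVal_def)
  with assms show ?thesis
    unfolding eval_map_def by (metis UnI1 fun_upd_apply)
qed

lemma closed_proc_imp_proc_state: "closed_proc S p \<Longrightarrow> proc_state S p"
  unfolding closed_proc_def proc_state_def
  by (induction p) (auto simp: eval_map_imp_ext_eval_map)

lemma closed_data_dsubst:
  assumes "ext_eval_map S \<sigma>" "closed_data S e"
  shows "closed_data S (dsubst \<sigma> e) \<and> (\<forall>w\<in>fvars (dsubst \<sigma> e). \<sigma> w = FVar w)"
proof -
  have "well_sorted S e \<Longrightarrow> lvars e = {} \<Longrightarrow>
      well_sorted S (dsubst \<sigma> e) \<and> sort_of S (dsubst \<sigma> e) = sort_of S e \<and>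
      lvars (dsubst \<sigma> e) = {} \<and> (\<forall>w\<in>fvars (dsubst \<sigma> e). \<sigma> w = FVar w)"
  proof (induction e)
    case (Op f ts)
    then have *: "\<And>t. t \<in> set ts \<Longrightarrow> well_sorted S (dsubst \<sigma> t) \<and>
        sort_of S (dsubst \<sigma> t) = sort_of S t \<and>
        lvars (dsubst \<sigma> t) = {} \<and> (\<forall>w\<in>fvars (dsubst \<sigma> t). \<sigma> w = FVar w)"
      by (auto simp: list_all_iff)
    then have "map (sort_of S \<circ> dsubst \<sigma>) ts = map (sort_of S) ts"
      by simp
    with * Op.prems show ?case
      by (auto simp: list_all_iff)
  next
    case (FVar v)
    then show ?case
    proof (cases "\<sigma> v = FVar v")
      case False
      with assms(1) have "closed_data S (\<sigma> v)" "\<forall>w\<in>fvars (\<sigma> v). \<sigma> w = FVar w"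
        unfolding ext_eval_map_def by blast+
      then show ?thesis by (simp add: closed_data_def)
    qed simp
  qed simp
  with assms(2) show ?thesis
    by (simp add: closed_data_def)
qed

lemma ext_eval_map_update:
  assumes "ext_eval_map S \<sigma>" "closed_data S e" "\<sigma> v \<noteq> FVar v"
  shows "ext_eval_map S (\<sigma>(v := dsubst \<sigma> e))"
  unfolding ext_eval_map_def
proof
  fix u
  let ?\<tau> = "\<sigma>(v := dsubst \<sigma> e)"
  note e = closed_data_dsubst[OF assms(1,2)]
  have fixed: "?\<tau> w = FVar w" if "\<sigma> w = FVar w" for w
    using assms(3) that by auto
  show "?\<tau> u = FVar u \<or> closed_data S (?\<tau> u) \<and> (\<forall>w\<in>fvars (?\<tau> u). ?\<tau> w = FVar w)"
  proof (cases "u = v")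
    case True
    with e fixed show ?thesis by (simp del: fun_upd_apply add: fun_upd_same)
  next
    case False
    then have "?\<tau> u = \<sigma> u" by simp
    with assms(1) fixed show ?thesis
      unfolding ext_eval_map_def by metis
  qed
qed

lemma step_proc_state:
  assumes "step \<DD> \<gamma> p \<phi> \<alpha> p'" "proc_state \<DD> p"
  shows "closed_action \<DD> \<alpha> \<and> proc_state \<DD> p'"
  using assms unfolding proc_state_def
  by (induction rule: step.induct) (simp_all add: closed_data_dsubst[THEN conjunct1] ext_eval_map_update del: fun_upd_apply)

end

theory Submission
  imports Defs
begin

text \<open>Every closed process term has only finitely many transitions. Hence the clauses of a
  bisimulation, which match a transition under \<open>\<phi>\<close> by finitely many transitions whose conditions
  cover \<open>\<phi>\<close>, can be checked valuation by valuation: once the values of the flexible variables are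
  fixed, a condition merely enables or disables a transition, and each operator becomes an
  unconditional one. For the latter the usual coinductive congruence arguments apply. The only
  twist is evaluation: bisimilar processes may perform syntactically different but equivalent
  assignments, so one has to relate \<open>V\<^sub>\<sigma>(p)\<close> and \<open>V\<^sub>\<tau>(q)\<close> for maps \<open>\<sigma>\<close>, \<open>\<tau>\<close> that
  are pointwise equal in the data algebra and leave the same flexible variables unevaluated.\<close>

section \<open>Finite branching\<close>

text \<open>A cover \<open>\<Psi>\<close> is uniform in the valuation, whereas the pointwise reading
  lets different valuations satisfying \<open>\<phi>\<close> choose different matches. Finite
  branching bridges the gap: the set of the conditions of all matching transitions is itself an
  admissible cover. Working with covers directly would mean building, for every operator, a cover of
  a conjunction or of a substituted condition from covers for the components. The pointwise view
  also absorbs the provisos that exclude conditions equivalent to \<open>CFalse\<close>: a condition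
  that holds at the current valuation is satisfiable. The valuation is fixed for a single transition
  only. Targets have to match again at all valuations, and data equivalence of labels likewise
  refers to all of them. Evaluation exploits this: \<open>Eval \<sigma> x\<close> behaves at one
  valuation as \<open>x\<close> does at another, namely the one that \<open>\<sigma>\<close>
  induces.\<close>

inductive_cases terminates_DeltaE: "terminates \<DD> Delta \<phi>"
inductive_cases terminates_EpsE: "terminates \<DD> Eps \<phi>"
inductive_cases terminates_ActE: "terminates \<DD> (Act \<alpha>) \<phi>"
inductive_cases terminates_AltE: "terminates \<DD> (Alt x y) \<phi>"
inductive_cases terminates_SeqE: "terminates \<DD> (Seq x y) \<phi>"
inductive_cases terminates_IterE: "terminates \<DD> (Iter x y) \<phi>"
inductive_cases terminates_GuardE: "terminates \<DD> (Guard \<psi> x) \<phi>"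
inductive_cases terminates_ParE: "terminates \<DD> (Par x y) \<phi>"
inductive_cases terminates_LMergeE: "terminates \<DD> (LMerge x y) \<phi>"
inductive_cases terminates_CMergeE: "terminates \<DD> (CMerge x y) \<phi>"
inductive_cases terminates_EncapE: "terminates \<DD> (Encap H x) \<phi>"
inductive_cases terminates_EvalE: "terminates \<DD> (Eval \<sigma> x) \<phi>"

lemmas terminates_elims =
  terminates_DeltaE terminates_EpsE terminates_ActE terminates_AltE terminates_SeqE
  terminates_IterE terminates_GuardE terminates_ParE terminates_LMergeE terminates_CMergeE
  terminates_EncapE terminates_EvalE

inductive_cases step_DeltaE: "step \<DD> \<gamma> Delta \<phi> \<alpha> z"
inductive_cases step_EpsE: "step \<DD> \<gamma> Eps \<phi> \<alpha> z"
inductive_cases step_ActE: "step \<DD> \<gamma> (Act \<beta>) \<phi> \<alpha> z"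
inductive_cases step_AltE: "step \<DD> \<gamma> (Alt x y) \<phi> \<alpha> z"
inductive_cases step_SeqE: "step \<DD> \<gamma> (Seq x y) \<phi> \<alpha> z"
inductive_cases step_IterE: "step \<DD> \<gamma> (Iter x y) \<phi> \<alpha> z"
inductive_cases step_GuardE: "step \<DD> \<gamma> (Guard \<psi> x) \<phi> \<alpha> z"
inductive_cases step_ParE: "step \<DD> \<gamma> (Par x y) \<phi> \<alpha> z"
inductive_cases step_LMergeE: "step \<DD> \<gamma> (LMerge x y) \<phi> \<alpha> z"
inductive_cases step_CMergeE: "step \<DD> \<gamma> (CMerge x y) \<phi> \<alpha> z"
inductive_cases step_EncapE: "step \<DD> \<gamma> (Encap H x) \<phi> \<alpha> z"
inductive_cases step_EvalE: "step \<DD> \<gamma> (Eval \<sigma> x) \<phi> \<alpha> z"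

lemmas step_elims =
  step_DeltaE step_EpsE step_ActE step_AltE step_SeqE step_IterE step_GuardE step_ParE
  step_LMergeE step_CMergeE step_EncapE step_EvalE

text \<open>Every rule concludes from terminations of immediate subterms, so the conditions of a
  compound term lie in an image of finitely many conditions, or of finitely many pairs of
  them.\<close>

lemma finite_terminates: "finite {\<phi>. terminates \<DD> p \<phi>}"
proof (induction p)
  case Delta
  show ?case by (rule finite_subset[of _ "{}"]) (auto elim: terminates_elims)
next
  case Eps
  show ?case by (rule finite_subset[of _ "{CTrue}"]) (auto elim: terminates_elims)
next
  case (Act \<alpha>)
  show ?case by (rule finite_subset[of _ "{}"]) (auto elim: terminates_elims)
next
  case (Alt p q)
  show ?case
    by (rule finite_subset[of _ "{\<phi>. terminates \<DD> p \<phi>} \<union> {\<phi>. terminates \<DD> q \<phi>}"])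
      (auto simp: Alt.IH elim: terminates_elims)
next
  case (Seq p q)
  show ?case
    by (rule finite_subset[of _ "case_prod CAnd ` ({\<phi>. terminates \<DD> p \<phi>} \<times> {\<phi>. terminates \<DD> q \<phi>})"])
      (auto simp: Seq.IH elim!: terminates_elims)
next
  case (Iter p q)
  show ?case
    by (rule finite_subset[of _ "{\<phi>. terminates \<DD> q \<phi>}"]) (auto simp: Iter.IH elim: terminates_elims)
next
  case (Par p q)
  show ?case
    by (rule finite_subset[of _ "case_prod CAnd ` ({\<phi>. terminates \<DD> p \<phi>} \<times> {\<phi>. terminates \<DD> q \<phi>})"])
      (auto simp: Par.IH elim!: terminates_elims)
next
  case (LMerge p q)
  show ?case by (rule finite_subset[of _ "{}"]) (auto elim: terminates_elims)
next
  case (CMerge p q)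
  show ?case by (rule finite_subset[of _ "{}"]) (auto elim: terminates_elims)
next
  case (Encap H p)
  show ?case
    by (rule finite_subset[of _ "{\<phi>. terminates \<DD> p \<phi>}"]) (auto simp: Encap.IH elim: terminates_elims)
next
  case (Guard \<psi> p)
  show ?case
    by (rule finite_subset[of _ "(\<lambda>\<phi>. CAnd \<phi> \<psi>) ` {\<phi>. terminates \<DD> p \<phi>}"])
      (auto simp: Guard.IH elim!: terminates_elims)
next
  case (Eval \<sigma> p)
  show ?case
    by (rule finite_subset[of _ "csubst \<sigma> ` {\<phi>. terminates \<DD> p \<phi>}"])
      (auto simp: Eval.IH elim!: terminates_elims)
qed

text \<open>With \<open>eval_update\<close>, this folds the four evaluation rules into the single
  equivalence \<open>step_Eval_iff\<close>, uniform in the kind of action.\<close>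

primrec action_subst ::
  "('v \<Rightarrow> ('f, 'v) dterm) \<Rightarrow> ('a, 'f, 'v) action \<Rightarrow> ('a, 'f, 'v) action" where
  "action_subst \<sigma> (Basic a) = Basic a"
| "action_subst \<sigma> (Param a es) = Param a (map (dsubst \<sigma>) es)"
| "action_subst \<sigma> (Assign v e) = Assign v (dsubst \<sigma> e)"

primrec eval_update ::
  "('v \<Rightarrow> ('f, 'v) dterm) \<Rightarrow> ('a, 'f, 'v) action \<Rightarrow> 'v \<Rightarrow> ('f, 'v) dterm" where
  "eval_update \<sigma> (Basic a) = \<sigma>"
| "eval_update \<sigma> (Param a es) = \<sigma>"
| "eval_update \<sigma> (Assign v e) = (if \<sigma> v = FVar v then \<sigma> else \<sigma>(v := dsubst \<sigma> e))"

lemma step_Eval_iff: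
  "step \<DD> \<gamma> (Eval \<sigma> x) \<chi> \<alpha> z \<longleftrightarrow>
    (\<exists>\<phi> \<beta> x'. step \<DD> \<gamma> x \<phi> \<beta> x' \<and> csubst \<sigma> \<phi> \<in> Cs \<DD> \<and> \<chi> = csubst \<sigma> \<phi> \<and>
      \<alpha> = action_subst \<sigma> \<beta> \<and> z = Eval (eval_update \<sigma> \<beta>) x')" (is "_ \<longleftrightarrow> ?rhs")
proof
  assume "step \<DD> \<gamma> (Eval \<sigma> x) \<chi> \<alpha> z"
  then show ?rhs
  proof (cases rule: step_EvalE[consumes 1, case_names Basic Param Update Skip])
    case (Basic \<phi> a x')
    then show ?thesis by (intro exI[of _ \<phi>] exI[of _ "Basic a"] exI[of _ x']) simp
  next
    case (Param \<phi> a es x')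
    then show ?thesis by (intro exI[of _ \<phi>] exI[of _ "Param a es"] exI[of _ x']) simp
  next
    case (Update \<phi> v e x')
    then show ?thesis by (intro exI[of _ \<phi>] exI[of _ "Assign v e"] exI[of _ x']) simp
  next
    case (Skip \<phi> v e x')
    then show ?thesis by (intro exI[of _ \<phi>] exI[of _ "Assign v e"] exI[of _ x']) simp
  qed
next
  assume ?rhs
  then obtain \<phi> \<beta> x' where "step \<DD> \<gamma> x \<phi> \<beta> x'" "csubst \<sigma> \<phi> \<in> Cs \<DD>" "\<chi> = csubst \<sigma> \<phi>"
    "\<alpha> = action_subst \<sigma> \<beta>" "z = Eval (eval_update \<sigma> \<beta>) x'"
    by blast
  then show "step \<DD> \<gamma> (Eval \<sigma> x) \<chi> \<alpha> z"
    by (cases \<beta>) (auto intro: step.intros)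
qed

text \<open>Serves only to exhibit communications as part of the image of a product of two finite
  sets. Since a superset is enough, the function may be total, with arbitrary values where the
  actions do not communicate: \<open>the\<close> of \<open>None\<close>, parameter lists of
  different lengths, or the last clause.\<close>

fun comm_result ::
  "('a option \<Rightarrow> 'a option \<Rightarrow> 'a option) \<Rightarrow> ('f, 'v) cond \<times> ('a, 'f, 'v) action \<times> ('a, 'f, 'v) proc \<Rightarrow>
   ('f, 'v) cond \<times> ('a, 'f, 'v) action \<times> ('a, 'f, 'v) proc \<Rightarrow>
   ('f, 'v) cond \<times> ('a, 'f, 'v) action \<times> ('a, 'f, 'v) proc" where
  "comm_result \<gamma> (\<phi>, Basic a, x) (\<psi>, Basic b, y) =
     (CAnd \<phi> \<psi>, Basic (the (\<gamma> (Some a) (Some b))), Par x y)"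
| "comm_result \<gamma> (\<phi>, Param a es, x) (\<psi>, Param b es', y) =
     (conj_eqs (CAnd \<phi> \<psi>) es es', Param (the (\<gamma> (Some a) (Some b))) es, Par x y)"
| "comm_result \<gamma> s t = s"

lemma step_comm_result:
  assumes "step \<DD> \<gamma> (CMerge x y) \<chi> \<kappa> z"
  obtains s t where "s \<in> {(\<phi>, \<alpha>, x'). step \<DD> \<gamma> x \<phi> \<alpha> x'}" "t \<in> {(\<phi>, \<alpha>, y'). step \<DD> \<gamma> y \<phi> \<alpha> y'}"
    "(\<chi>, \<kappa>, z) = comm_result \<gamma> s t"
  using assms
proof (cases rule: step_CMergeE[consumes 1, case_names Basic Param])
  case (Basic \<phi> a x' \<psi> b y' c)
  then show ?thesis using that[of "(\<phi>, Basic a, x')" "(\<psi>, Basic b, y')"] by simp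
next
  case (Param \<phi> a es x' \<psi> b es' y' c)
  then show ?thesis using that[of "(\<phi>, Param a es, x')" "(\<psi>, Param b es', y')"] by simp
qed

text \<open>Synchronisation in \<open>Par\<close> has the same premises, label and target as in
  \<open>CMerge\<close>, so communication has to be analysed only for \<open>CMerge\<close>.\<close>

lemma step_Par_iff:
  "step \<DD> \<gamma> (Par x y) \<chi> \<kappa> z \<longleftrightarrow>
    (\<exists>x'. step \<DD> \<gamma> x \<chi> \<kappa> x' \<and> z = Par x' y) \<or> (\<exists>y'. step \<DD> \<gamma> y \<chi> \<kappa> y' \<and> z = Par x y') \<or>
    step \<DD> \<gamma> (CMerge x y) \<chi> \<kappa> z"
  by (auto elim!: step_ParE step_CMergeE intro: step.intros)

lemma finite_steps_CMerge:
  assumes "finite {(\<phi>, \<alpha>, p'). step \<DD> \<gamma> p \<phi> \<alpha> p'}" (is "finite ?P")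
    and "finite {(\<phi>, \<alpha>, q'). step \<DD> \<gamma> q \<phi> \<alpha> q'}" (is "finite ?Q")
  shows "finite {(\<phi>, \<alpha>, z). step \<DD> \<gamma> (CMerge p q) \<phi> \<alpha> z}"
proof (rule finite_subset)
  show "{(\<phi>, \<alpha>, z). step \<DD> \<gamma> (CMerge p q) \<phi> \<alpha> z} \<subseteq> (\<lambda>(s, t). comm_result \<gamma> s t) ` (?P \<times> ?Q)"
  proof clarify
    fix \<phi> \<alpha> z assume "step \<DD> \<gamma> (CMerge p q) \<phi> \<alpha> z"
    then obtain s t where "s \<in> ?P" "t \<in> ?Q" "(\<phi>, \<alpha>, z) = comm_result \<gamma> s t"
      by (rule step_comm_result)
    then show "(\<phi>, \<alpha>, z) \<in> (\<lambda>(s, t). comm_result \<gamma> s t) ` (?P \<times> ?Q)"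
      by (intro image_eqI[of _ _ "(s, t)"]) auto
  qed
qed (use assms in simp)

lemma finite_steps: "finite {(\<phi>, \<alpha>, p'). step \<DD> \<gamma> p \<phi> \<alpha> p'}"
proof (induction p)
  case Delta
  show ?case by (rule finite_subset[of _ "{}"]) (auto elim: step_elims)
next
  case Eps
  show ?case by (rule finite_subset[of _ "{}"]) (auto elim: step_elims)
next
  case (Act \<alpha>)
  show ?case by (rule finite_subset[of _ "{(CTrue, \<alpha>, Eps)}"]) (auto elim: step_elims)
next
  case (Alt p q)
  show ?case
    by (rule finite_subset[of _ "{(\<phi>, \<alpha>, p'). step \<DD> \<gamma> p \<phi> \<alpha> p'} \<union> {(\<phi>, \<alpha>, q'). step \<DD> \<gamma> q \<phi> \<alpha> q'}"])
      (auto simp: Alt.IH elim: step_elims)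
next
  case (Seq p q)
  show ?case
    by (rule finite_subset[of _ "(\<lambda>(\<phi>, \<alpha>, p'). (\<phi>, \<alpha>, Seq p' q)) ` {(\<phi>, \<alpha>, p'). step \<DD> \<gamma> p \<phi> \<alpha> p'} \<union>
          (\<lambda>(\<phi>, \<psi>, \<alpha>, q'). (CAnd \<phi> \<psi>, \<alpha>, q')) `
            ({\<phi>. terminates \<DD> p \<phi>} \<times> {(\<phi>, \<alpha>, q'). step \<DD> \<gamma> q \<phi> \<alpha> q'})"])
      (force elim!: step_elims simp: Seq.IH finite_terminates)+
next
  case (Iter p q)
  \<comment> \<open>The target contains the iteration itself, but the transition stems from a proper
    subterm, so structural induction still applies.\<close>
  show ?case
    by (rule finite_subset[of _ "{(\<phi>, \<alpha>, q'). step \<DD> \<gamma> q \<phi> \<alpha> q'} \<union>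
          (\<lambda>(\<phi>, \<alpha>, p'). (\<phi>, \<alpha>, Seq p' (Iter p q))) ` {(\<phi>, \<alpha>, p'). step \<DD> \<gamma> p \<phi> \<alpha> p'}"])
      (force simp: Iter.IH elim!: step_elims)+
next
  case (Par p q)
  show ?case
    by (rule finite_subset[of _ "(\<lambda>(\<phi>, \<alpha>, p'). (\<phi>, \<alpha>, Par p' q)) ` {(\<phi>, \<alpha>, p'). step \<DD> \<gamma> p \<phi> \<alpha> p'} \<union>
          (\<lambda>(\<phi>, \<alpha>, q'). (\<phi>, \<alpha>, Par p q')) ` {(\<phi>, \<alpha>, q'). step \<DD> \<gamma> q \<phi> \<alpha> q'} \<union>
          {(\<phi>, \<alpha>, z). step \<DD> \<gamma> (CMerge p q) \<phi> \<alpha> z}"])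
      (force simp: Par.IH step_Par_iff finite_steps_CMerge)+
next
  case (LMerge p q)
  show ?case
    by (rule finite_subset[of _ "(\<lambda>(\<phi>, \<alpha>, p'). (\<phi>, \<alpha>, Par p' q)) ` {(\<phi>, \<alpha>, p'). step \<DD> \<gamma> p \<phi> \<alpha> p'}"])
      (force simp: LMerge.IH elim!: step_elims)+
next
  case (CMerge p q)
  then show ?case by (rule finite_steps_CMerge)
next
  case (Encap H p)
  show ?case
    by (rule finite_subset[of _ "(\<lambda>(\<phi>, \<alpha>, p'). (\<phi>, \<alpha>, Encap H p')) ` {(\<phi>, \<alpha>, p'). step \<DD> \<gamma> p \<phi> \<alpha> p'}"])
      (force simp: Encap.IH elim!: step_elims)+
next
  case (Guard \<psi> p)
  show ?case
    by (rule finite_subset[of _ "(\<lambda>(\<phi>, \<alpha>, p'). (CAnd \<phi> \<psi>, \<alpha>, p')) ` {(\<phi>, \<alpha>, p'). step \<DD> \<gamma> p \<phi> \<alpha> p'}"])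
      (force simp: Guard.IH elim!: step_elims)+
next
  case (Eval \<sigma> p)
  show ?case
    by (rule finite_subset[of _ "(\<lambda>(\<phi>, \<beta>, p'). (csubst \<sigma> \<phi>, action_subst \<sigma> \<beta>, Eval (eval_update \<sigma> \<beta>) p')) `
          {(\<phi>, \<alpha>, p'). step \<DD> \<gamma> p \<phi> \<alpha> p'}"])
      (force simp: Eval.IH step_Eval_iff)+
qed

section \<open>Closedness of conditions and substitution\<close>

lemma closed_cond_CAnd [simp]:
  "closed_cond S (CAnd \<phi> \<psi>) \<longleftrightarrow> closed_cond S \<phi> \<and> closed_cond S \<psi>"
  by (auto simp: closed_cond_def)

lemma closed_cond_CTrue [simp]: "closed_cond S CTrue"
  by (simp add: closed_cond_def)

lemma closed_cond_conj_eqs: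
  assumes "closed_cond S \<chi>" "\<forall>e\<in>set es. closed_data S e" "\<forall>e\<in>set es'. closed_data S e"
  shows "closed_cond S (conj_eqs \<chi> es es')"
  using assms
proof (induction es arbitrary: es' \<chi>)
  case (Cons e es)
  then show ?case
    by (cases es') (auto simp: conj_eqs_def closed_cond_def closed_data_def)
qed (simp add: conj_eqs_def)

lemma sat_conj_eqs:
  assumes "length es = length es'"
  shows "sat \<DD> \<rho> \<theta> (conj_eqs \<chi> es es') \<longleftrightarrow>
    sat \<DD> \<rho> \<theta> \<chi> \<and> map (dval \<DD> \<rho> \<theta>) es = map (dval \<DD> \<rho> \<theta>) es'"
  using assms
  by (induction es es' arbitrary: \<chi> rule: list_induct2) (auto simp: conj_eqs_def)

text \<open>A condition is \<open>CTrue\<close>, is inherited, or is constrained by its rule to lie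
  in \<open>Cs\<close>, all of whose members are closed. The claim therefore holds for arbitrary
  terms.\<close>

lemma terminates_closed_cond: "terminates \<DD> p \<phi> \<Longrightarrow> closed_cond \<DD> \<phi>"
  by (induction rule: terminates.induct) (auto simp: Cs_def)

lemma step_closed_cond: "step \<DD> \<gamma> p \<phi> \<alpha> p' \<Longrightarrow> closed_cond \<DD> \<phi>"
  by (induction rule: step.induct) (auto simp: Cs_def)

lemma ext_eval_map_closed_data: "ext_eval_map S \<sigma> \<Longrightarrow> closed_data S (\<sigma> v)"
  using closed_data_dsubst[of S \<sigma> "FVar v"] by (simp add: closed_data_def)

text \<open>Below quantifiers, terms contain logical variables, so \<open>closed_data_dsubst\<close>
  does not suffice for conditions. Equality of \<open>lvars\<close> is what preserves the free
  variables of a condition under \<open>csubst\<close>.\<close>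

lemma well_sorted_dsubst:
  assumes "ext_eval_map S \<sigma>"
  shows "(well_sorted S e \<longrightarrow> well_sorted S (dsubst \<sigma> e)) \<and>
    sort_of S (dsubst \<sigma> e) = sort_of S e \<and> lvars (dsubst \<sigma> e) = lvars e"
proof (induction e)
  case (Op f ts)
  then have "map (sort_of S \<circ> dsubst \<sigma>) ts = map (sort_of S) ts"
    by simp
  then show ?case using Op by (auto simp: list_all_iff simp del: map_eq_conv)
next
  case (FVar v)
  then show ?case using ext_eval_map_closed_data[OF assms, of v] by (simp add: closed_data_def)
qed simp

lemma closed_cond_csubst:
  assumes "ext_eval_map S \<sigma>" "closed_cond S \<phi>"
  shows "closed_cond S (csubst \<sigma> \<phi>)"
proof -
  have "well_formed_cond S \<phi> \<Longrightarrow> well_formed_cond S (csubst \<sigma> \<phi>)"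
    by (induction \<phi>) (auto simp: well_sorted_dsubst[OF assms(1)])
  moreover have "free_lvars (csubst \<sigma> \<phi>) = free_lvars \<phi>"
    by (induction \<phi>) (auto simp: well_sorted_dsubst[OF assms(1)])
  ultimately show ?thesis
    using assms(2) by (simp add: closed_cond_def)
qed

lemma dval_cong_lvars: "lvars e = {} \<Longrightarrow> dval \<DD> \<rho> \<theta> e = dval \<DD> \<rho> \<theta>' e"
proof (induction e)
  case (Op f ts)
  then have "map (dval \<DD> \<rho> \<theta>) ts = map (dval \<DD> \<rho> \<theta>') ts"
    by auto
  then show ?case by (simp only: dval.simps)
qed simp_all

lemma dval_dsubst: "dval \<DD> \<rho> \<theta> (dsubst \<sigma> e) = dval \<DD> (\<lambda>v. dval \<DD> \<rho> \<theta> (\<sigma> v)) \<theta> e"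
proof (induction e)
  case (Op f ts)
  then have "map (dval \<DD> \<rho> \<theta> \<circ> dsubst \<sigma>) ts = map (dval \<DD> (\<lambda>v. dval \<DD> \<rho> \<theta> (\<sigma> v)) \<theta>) ts"
    by simp
  then show ?case by (simp only: dval.simps dsubst.simps map_map)
qed simp_all

text \<open>The substitution lemma: applying \<open>\<sigma>\<close> to the condition amounts to
  changing the valuation of the flexible variables. The induction passes quantifiers because the
  terms \<open>\<sigma> v\<close> contain no logical variables, so rebinding \<open>X\<close> in
  \<open>\<theta>\<close> leaves their values alone.\<close>

lemma sat_csubst:
  assumes "\<And>v. lvars (\<sigma> v) = {}"
  shows "sat \<DD> \<rho> \<theta> (csubst \<sigma> \<phi>) \<longleftrightarrow> sat \<DD> (\<lambda>v. dval \<DD> \<rho> \<theta> (\<sigma> v)) \<theta> \<phi>"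
proof (induction \<phi> arbitrary: \<theta>)
  case (CAll X \<phi>)
  have "(\<lambda>v. dval \<DD> \<rho> (\<theta>(X := u)) (\<sigma> v)) = (\<lambda>v. dval \<DD> \<rho> \<theta> (\<sigma> v))" for u
    using assms dval_cong_lvars by blast
  then show ?case by (simp add: CAll del: fun_upd_apply)
next
  case (CEx X \<phi>)
  have "(\<lambda>v. dval \<DD> \<rho> (\<theta>(X := u)) (\<sigma> v)) = (\<lambda>v. dval \<DD> \<rho> \<theta> (\<sigma> v))" for u
    using assms dval_cong_lvars by blast
  then show ?case by (simp add: CEx del: fun_upd_apply)
qed (simp_all add: dval_dsubst)

section \<open>Transitions under a fixed valuation\<close>

text \<open>At a fixed valuation the equations between parameters move out of the condition and
  become a test on values; this is why the relation depends on \<open>\<rho>\<close> and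
  \<open>\<theta>\<close>.\<close>

inductive communicates ::
  "('s, 'f, 'u) data_algebra \<Rightarrow> ('a option \<Rightarrow> 'a option \<Rightarrow> 'a option) \<Rightarrow> ('v \<Rightarrow> 'u) \<Rightarrow> (nat \<Rightarrow> 'u) \<Rightarrow>
   ('a, 'f, 'v) action \<Rightarrow> ('a, 'f, 'v) action \<Rightarrow> ('a, 'f, 'v) action \<Rightarrow> bool"
  for \<DD> :: "('s, 'f, 'u) data_algebra" and \<gamma> \<rho> \<theta> where
  "\<gamma> (Some a) (Some b) = Some c \<Longrightarrow> communicates \<DD> \<gamma> \<rho> \<theta> (Basic a) (Basic b) (Basic c)"
| "\<gamma> (Some a) (Some b) = Some c \<Longrightarrow> length es = length es' \<Longrightarrow>
     map (dval \<DD> \<rho> \<theta>) es = map (dval \<DD> \<rho> \<theta>) es' \<Longrightarrow>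
     communicates \<DD> \<gamma> \<rho> \<theta> (Param a es) (Param b es') (Param c es)"

primrec unblocked :: "'a set \<Rightarrow> ('a, 'f, 'v) action \<Rightarrow> bool" where
  "unblocked H (Basic a) \<longleftrightarrow> a \<notin> H"
| "unblocked H (Param a es) \<longleftrightarrow> a \<notin> H"
| "unblocked H (Assign v e) \<longleftrightarrow> True"

definition halts ::
  "('s, 'f, 'u) data_algebra \<Rightarrow> ('v \<Rightarrow> 'u) \<Rightarrow> (nat \<Rightarrow> 'u) \<Rightarrow> ('a, 'f, 'v) proc \<Rightarrow> bool" where
  "halts \<DD> \<rho> \<theta> p \<longleftrightarrow> (\<exists>\<phi>. terminates \<DD> p \<phi> \<and> sat \<DD> \<rho> \<theta> \<phi>)"

definition fires ::
  "('s, 'f, 'u) data_algebra \<Rightarrow> ('a option \<Rightarrow> 'a option \<Rightarrow> 'a option) \<Rightarrow> ('v \<Rightarrow> 'u) \<Rightarrow> (nat \<Rightarrow> 'u) \<Rightarrow>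
   ('a, 'f, 'v) proc \<Rightarrow> ('a, 'f, 'v) action \<Rightarrow> ('a, 'f, 'v) proc \<Rightarrow> bool" where
  "fires \<DD> \<gamma> \<rho> \<theta> p \<alpha> p' \<longleftrightarrow> (\<exists>\<phi>. step \<DD> \<gamma> p \<phi> \<alpha> p' \<and> sat \<DD> \<rho> \<theta> \<phi>)"

definition valuations :: "('s, 'f, 'u) data_algebra \<Rightarrow> ('v \<Rightarrow> 'u) \<Rightarrow> (nat \<Rightarrow> 'u) \<Rightarrow> bool" where
  "valuations \<DD> \<rho> \<theta> \<longleftrightarrow> range \<rho> \<subseteq> carr \<DD> (dsort \<DD>) \<and> range \<theta> \<subseteq> carr \<DD> (dsort \<DD>)"

lemma valid_iff: "valid \<DD> \<phi> \<longleftrightarrow> (\<forall>\<rho> \<theta>. valuations \<DD> \<rho> \<theta> \<longrightarrow> sat \<DD> \<rho> \<theta> \<phi>)"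
  by (auto simp: valid_def valuations_def)

text \<open>A satisfying valuation witnesses that the condition is not equivalent to
  \<open>CFalse\<close>. This discharges the membership provisos of the rules whenever a transition
  is built at a fixed valuation.\<close>

lemma in_Cs_if_sat:
  assumes "closed_cond \<DD> \<phi>" "valuations \<DD> \<rho> \<theta>" "sat \<DD> \<rho> \<theta> \<phi>"
  shows "\<phi> \<in> Cs \<DD>"
  using assms by (auto simp: Cs_def valid_iff)

lemma proc_state_simps [simp]:
  "proc_state S Eps"
  "proc_state S (Alt p q) \<longleftrightarrow> proc_state S p \<and> proc_state S q"
  "proc_state S (Seq p q) \<longleftrightarrow> proc_state S p \<and> proc_state S q"
  "proc_state S (Iter p q) \<longleftrightarrow> proc_state S p \<and> proc_state S q"
  "proc_state S (Par p q) \<longleftrightarrow> proc_state S p \<and> proc_state S q"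
  "proc_state S (LMerge p q) \<longleftrightarrow> proc_state S p \<and> proc_state S q"
  "proc_state S (CMerge p q) \<longleftrightarrow> proc_state S p \<and> proc_state S q"
  "proc_state S (Encap H p) \<longleftrightarrow> proc_state S p"
  "proc_state S (Guard \<phi> p) \<longleftrightarrow> closed_cond S \<phi> \<and> proc_state S p"
  "proc_state S (Eval \<sigma> p) \<longleftrightarrow> ext_eval_map S \<sigma> \<and> proc_state S p"
  by (simp_all add: proc_state_def)

lemma fires_proc_state:
  assumes "fires \<DD> \<gamma> \<rho> \<theta> p \<alpha> p'" "proc_state \<DD> p"
  shows "closed_action \<DD> \<alpha>" "proc_state \<DD> p'"
  using assms by (auto simp: fires_def dest: step_proc_state)

section \<open>Termination of compound processes at a fixed valuation\<close>

lemma halts_Alt: "halts \<DD> \<rho> \<theta> (Alt x y) \<longleftrightarrow> halts \<DD> \<rho> \<theta> x \<or> halts \<DD> \<rho> \<theta> y"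
  by (auto simp: halts_def elim: terminates_elims intro: terminates.intros)

lemma halts_Iter: "halts \<DD> \<rho> \<theta> (Iter x y) \<longleftrightarrow> halts \<DD> \<rho> \<theta> y"
  by (auto simp: halts_def elim: terminates_elims intro: terminates.intros)

lemma halts_LMerge: "\<not> halts \<DD> \<rho> \<theta> (LMerge x y)"
  by (auto simp: halts_def elim: terminates_elims)

lemma halts_CMerge: "\<not> halts \<DD> \<rho> \<theta> (CMerge x y)"
  by (auto simp: halts_def elim: terminates_elims)

lemma halts_Encap: "halts \<DD> \<rho> \<theta> (Encap H x) \<longleftrightarrow> halts \<DD> \<rho> \<theta> x"
  by (auto simp: halts_def elim: terminates_elims intro: terminates.intros)

lemma halts_Seq:
  assumes "valuations \<DD> \<rho> \<theta>"
  shows "halts \<DD> \<rho> \<theta> (Seq x y) \<longleftrightarrow> halts \<DD> \<rho> \<theta> x \<and> halts \<DD> \<rho> \<theta> y"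
proof
  assume "halts \<DD> \<rho> \<theta> x \<and> halts \<DD> \<rho> \<theta> y"
  then obtain \<phi> \<psi> where *: "terminates \<DD> x \<phi>" "terminates \<DD> y \<psi>" "sat \<DD> \<rho> \<theta> (CAnd \<phi> \<psi>)"
    by (auto simp: halts_def)
  then have "CAnd \<phi> \<psi> \<in> Cs \<DD>"
    using assms by (auto intro!: in_Cs_if_sat dest: terminates_closed_cond)
  with * show "halts \<DD> \<rho> \<theta> (Seq x y)"
    unfolding halts_def by (blast intro: terminates.intros)
qed (auto simp: halts_def elim!: terminates_elims)

lemma halts_Par:
  assumes "valuations \<DD> \<rho> \<theta>"
  shows "halts \<DD> \<rho> \<theta> (Par x y) \<longleftrightarrow> halts \<DD> \<rho> \<theta> x \<and> halts \<DD> \<rho> \<theta> y"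
proof
  assume "halts \<DD> \<rho> \<theta> x \<and> halts \<DD> \<rho> \<theta> y"
  then obtain \<phi> \<psi> where *: "terminates \<DD> x \<phi>" "terminates \<DD> y \<psi>" "sat \<DD> \<rho> \<theta> (CAnd \<phi> \<psi>)"
    by (auto simp: halts_def)
  then have "CAnd \<phi> \<psi> \<in> Cs \<DD>"
    using assms by (auto intro!: in_Cs_if_sat dest: terminates_closed_cond)
  with * show "halts \<DD> \<rho> \<theta> (Par x y)"
    unfolding halts_def by (blast intro: terminates.intros)
qed (auto simp: halts_def elim!: terminates_elims)

lemma halts_Guard:
  assumes "valuations \<DD> \<rho> \<theta>" "closed_cond \<DD> \<psi>"
  shows "halts \<DD> \<rho> \<theta> (Guard \<psi> x) \<longleftrightarrow> halts \<DD> \<rho> \<theta> x \<and> sat \<DD> \<rho> \<theta> \<psi>"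
proof
  assume "halts \<DD> \<rho> \<theta> x \<and> sat \<DD> \<rho> \<theta> \<psi>"
  then obtain \<phi> where *: "terminates \<DD> x \<phi>" "sat \<DD> \<rho> \<theta> (CAnd \<phi> \<psi>)"
    by (auto simp: halts_def)
  then have "CAnd \<phi> \<psi> \<in> Cs \<DD>"
    using assms by (auto intro!: in_Cs_if_sat dest: terminates_closed_cond)
  with * show "halts \<DD> \<rho> \<theta> (Guard \<psi> x)"
    unfolding halts_def by (blast intro: terminates.intros)
qed (auto simp: halts_def elim!: terminates_elims)

text \<open>By \<open>sat_csubst\<close>, evaluating the condition is the same as testing the
  original one at the valuation induced by \<open>\<sigma>\<close>. The operator disappears at the
  price of a change of valuation.\<close>

lemma halts_Eval:
  assumes "valuations \<DD> \<rho> \<theta>" "ext_eval_map \<DD> \<sigma>"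
  shows "halts \<DD> \<rho> \<theta> (Eval \<sigma> x) \<longleftrightarrow> halts \<DD> (\<lambda>v. dval \<DD> \<rho> \<theta> (\<sigma> v)) \<theta> x"
proof -
  have lvars: "lvars (\<sigma> v) = {}" for v
    using ext_eval_map_closed_data[OF assms(2), of v] by (simp add: closed_data_def)
  show ?thesis
  proof
    assume "halts \<DD> (\<lambda>v. dval \<DD> \<rho> \<theta> (\<sigma> v)) \<theta> x"
    then obtain \<phi> where *: "terminates \<DD> x \<phi>" "sat \<DD> \<rho> \<theta> (csubst \<sigma> \<phi>)"
      by (auto simp: halts_def sat_csubst lvars)
    then have "csubst \<sigma> \<phi> \<in> Cs \<DD>"
      using assms by (auto intro!: in_Cs_if_sat closed_cond_csubst dest: terminates_closed_cond)
    with * show "halts \<DD> \<rho> \<theta> (Eval \<sigma> x)"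
      unfolding halts_def by (blast intro: terminates.intros)
  qed (auto simp: halts_def sat_csubst lvars elim!: terminates_elims)
qed

section \<open>Transitions of compound processes at a fixed valuation\<close>

lemma fires_Alt:
  "fires \<DD> \<gamma> \<rho> \<theta> (Alt x y) \<alpha> z \<longleftrightarrow> fires \<DD> \<gamma> \<rho> \<theta> x \<alpha> z \<or> fires \<DD> \<gamma> \<rho> \<theta> y \<alpha> z"
  by (auto simp: fires_def elim: step_elims intro: step.intros)

lemma fires_Iter:
  "fires \<DD> \<gamma> \<rho> \<theta> (Iter x y) \<alpha> z \<longleftrightarrow>
    fires \<DD> \<gamma> \<rho> \<theta> y \<alpha> z \<or> (\<exists>x'. fires \<DD> \<gamma> \<rho> \<theta> x \<alpha> x' \<and> z = Seq x' (Iter x y))"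
  by (auto simp: fires_def elim!: step_elims intro: step.intros)

lemma fires_LMerge:
  "fires \<DD> \<gamma> \<rho> \<theta> (LMerge x y) \<alpha> z \<longleftrightarrow> (\<exists>x'. fires \<DD> \<gamma> \<rho> \<theta> x \<alpha> x' \<and> z = Par x' y)"
  by (auto simp: fires_def elim!: step_elims intro: step.intros)

lemma fires_Encap:
  "fires \<DD> \<gamma> \<rho> \<theta> (Encap H x) \<alpha> z \<longleftrightarrow>
    unblocked H \<alpha> \<and> (\<exists>x'. fires \<DD> \<gamma> \<rho> \<theta> x \<alpha> x' \<and> z = Encap H x')"
  by (cases \<alpha>) (auto simp: fires_def elim!: step_elims intro: step.intros)

lemma fires_Seq:
  assumes "valuations \<DD> \<rho> \<theta>"
  shows "fires \<DD> \<gamma> \<rho> \<theta> (Seq x y) \<alpha> z \<longleftrightarrow>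
    halts \<DD> \<rho> \<theta> x \<and> fires \<DD> \<gamma> \<rho> \<theta> y \<alpha> z \<or> (\<exists>x'. fires \<DD> \<gamma> \<rho> \<theta> x \<alpha> x' \<and> z = Seq x' y)"
    (is "_ \<longleftrightarrow> ?now \<or> ?later")
proof
  assume "?now \<or> ?later"
  then show "fires \<DD> \<gamma> \<rho> \<theta> (Seq x y) \<alpha> z"
  proof
    assume ?now
    then obtain \<phi> \<psi> where *: "terminates \<DD> x \<phi>" "step \<DD> \<gamma> y \<psi> \<alpha> z" "sat \<DD> \<rho> \<theta> (CAnd \<phi> \<psi>)"
      by (auto simp: halts_def fires_def)
    then have "CAnd \<phi> \<psi> \<in> Cs \<DD>"
      using assms by (auto intro!: in_Cs_if_sat dest: terminates_closed_cond step_closed_cond)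
    with * show ?thesis
      unfolding fires_def by (blast intro: step.intros)
  qed (auto simp: fires_def intro: step.intros)
qed (auto simp: halts_def fires_def elim!: step_elims)

lemma fires_Guard:
  assumes "valuations \<DD> \<rho> \<theta>" "closed_cond \<DD> \<psi>"
  shows "fires \<DD> \<gamma> \<rho> \<theta> (Guard \<psi> x) \<alpha> z \<longleftrightarrow> fires \<DD> \<gamma> \<rho> \<theta> x \<alpha> z \<and> sat \<DD> \<rho> \<theta> \<psi>"
proof
  assume "fires \<DD> \<gamma> \<rho> \<theta> x \<alpha> z \<and> sat \<DD> \<rho> \<theta> \<psi>"
  then obtain \<phi> where *: "step \<DD> \<gamma> x \<phi> \<alpha> z" "sat \<DD> \<rho> \<theta> (CAnd \<phi> \<psi>)"
    by (auto simp: fires_def)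
  then have "CAnd \<phi> \<psi> \<in> Cs \<DD>"
    using assms by (auto intro!: in_Cs_if_sat dest: step_closed_cond)
  with * show "fires \<DD> \<gamma> \<rho> \<theta> (Guard \<psi> x) \<alpha> z"
    unfolding fires_def by (blast intro: step.intros)
qed (auto simp: fires_def elim!: step_elims)

lemma fires_CMerge:
  assumes "valuations \<DD> \<rho> \<theta>" "proc_state \<DD> x" "proc_state \<DD> y"
  shows "fires \<DD> \<gamma> \<rho> \<theta> (CMerge x y) \<kappa> z \<longleftrightarrow>
    (\<exists>\<alpha> \<beta> x' y'. fires \<DD> \<gamma> \<rho> \<theta> x \<alpha> x' \<and> fires \<DD> \<gamma> \<rho> \<theta> y \<beta> y' \<and>
      communicates \<DD> \<gamma> \<rho> \<theta> \<alpha> \<beta> \<kappa> \<and> z = Par x' y')" (is "_ \<longleftrightarrow> ?rhs")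
proof
  assume "fires \<DD> \<gamma> \<rho> \<theta> (CMerge x y) \<kappa> z"
  then obtain \<chi> where step: "step \<DD> \<gamma> (CMerge x y) \<chi> \<kappa> z" and "sat \<DD> \<rho> \<theta> \<chi>"
    by (auto simp: fires_def)
  from step show ?rhs
  proof (cases rule: step_CMergeE[consumes 1, case_names Basic Param])
    case (Basic \<phi> a x' \<psi> b y' c)
    then have "fires \<DD> \<gamma> \<rho> \<theta> x (Basic a) x'" "fires \<DD> \<gamma> \<rho> \<theta> y (Basic b) y'"
      using \<open>sat \<DD> \<rho> \<theta> \<chi>\<close> by (auto simp: fires_def)
    with Basic show ?thesis by (blast intro: communicates.intros)
  next
    case (Param \<phi> a es x' \<psi> b es' y' c)
    then have "fires \<DD> \<gamma> \<rho> \<theta> x (Param a es) x'" "fires \<DD> \<gamma> \<rho> \<theta> y (Param b es') y'"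
      "map (dval \<DD> \<rho> \<theta>) es = map (dval \<DD> \<rho> \<theta>) es'"
      using \<open>sat \<DD> \<rho> \<theta> \<chi>\<close> by (auto simp: fires_def sat_conj_eqs)
    with Param show ?thesis by (blast intro: communicates.intros)
  qed
next
  assume ?rhs
  then obtain \<alpha> \<beta> x' y' \<phi> \<psi> where steps: "step \<DD> \<gamma> x \<phi> \<alpha> x'" "step \<DD> \<gamma> y \<psi> \<beta> y'"
      "sat \<DD> \<rho> \<theta> \<phi>" "sat \<DD> \<rho> \<theta> \<psi>"
    and comm: "communicates \<DD> \<gamma> \<rho> \<theta> \<alpha> \<beta> \<kappa>" and z: "z = Par x' y'"
    by (auto simp: fires_def)
  \<comment> \<open>The condition of a communication mentions the parameters, so membership in
    \<open>Cs\<close> requires these to be closed; that is where \<open>proc_state\<close>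
    enters.\<close>
  have closed: "closed_cond \<DD> (CAnd \<phi> \<psi>)" "closed_action \<DD> \<alpha>" "closed_action \<DD> \<beta>"
    using steps assms by (auto dest: step_closed_cond step_proc_state)
  from comm show "fires \<DD> \<gamma> \<rho> \<theta> (CMerge x y) \<kappa> z"
  proof cases
    case (1 a b c)
    moreover have "CAnd \<phi> \<psi> \<in> Cs \<DD>"
      using closed assms(1) steps by (auto intro!: in_Cs_if_sat)
    ultimately have "step \<DD> \<gamma> (CMerge x y) (CAnd \<phi> \<psi>) \<kappa> z"
      using steps z by (auto intro: step.intros)
    with steps show ?thesis by (auto simp: fires_def)
  next
    case (2 a b c es es')
    then have sat: "sat \<DD> \<rho> \<theta> (conj_eqs (CAnd \<phi> \<psi>) es es')"
      using steps by (simp add: sat_conj_eqs)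
    moreover have "closed_cond \<DD> (conj_eqs (CAnd \<phi> \<psi>) es es')"
      using closed 2 by (intro closed_cond_conj_eqs) simp_all
    ultimately have "conj_eqs (CAnd \<phi> \<psi>) es es' \<in> Cs \<DD>"
      using assms(1) by (blast intro: in_Cs_if_sat)
    then have "step \<DD> \<gamma> (CMerge x y) (conj_eqs (CAnd \<phi> \<psi>) es es') \<kappa> z"
      using steps z 2 by (auto intro: step.intros)
    with sat show ?thesis by (auto simp: fires_def)
  qed
qed

lemma fires_Par:
  "fires \<DD> \<gamma> \<rho> \<theta> (Par x y) \<kappa> z \<longleftrightarrow>
    (\<exists>x'. fires \<DD> \<gamma> \<rho> \<theta> x \<kappa> x' \<and> z = Par x' y) \<or> (\<exists>y'. fires \<DD> \<gamma> \<rho> \<theta> y \<kappa> y' \<and> z = Par x y') \<or>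
    fires \<DD> \<gamma> \<rho> \<theta> (CMerge x y) \<kappa> z"
  by (auto simp: fires_def step_Par_iff)

lemma fires_Eval:
  assumes "valuations \<DD> \<rho> \<theta>" "ext_eval_map \<DD> \<sigma>"
  shows "fires \<DD> \<gamma> \<rho> \<theta> (Eval \<sigma> x) \<alpha> z \<longleftrightarrow>
    (\<exists>\<beta> x'. fires \<DD> \<gamma> (\<lambda>v. dval \<DD> \<rho> \<theta> (\<sigma> v)) \<theta> x \<beta> x' \<and>
      \<alpha> = action_subst \<sigma> \<beta> \<and> z = Eval (eval_update \<sigma> \<beta>) x')" (is "_ \<longleftrightarrow> ?rhs")
proof -
  have lvars: "lvars (\<sigma> v) = {}" for v
    using ext_eval_map_closed_data[OF assms(2), of v] by (simp add: closed_data_def)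
  show ?thesis
  proof
    assume ?rhs
    then obtain \<phi> \<beta> x' where *: "step \<DD> \<gamma> x \<phi> \<beta> x'" "sat \<DD> \<rho> \<theta> (csubst \<sigma> \<phi>)"
      "\<alpha> = action_subst \<sigma> \<beta>" "z = Eval (eval_update \<sigma> \<beta>) x'"
      by (auto simp: fires_def sat_csubst lvars)
    then have "csubst \<sigma> \<phi> \<in> Cs \<DD>"
      using assms by (auto intro!: in_Cs_if_sat closed_cond_csubst dest: step_closed_cond)
    with * show "fires \<DD> \<gamma> \<rho> \<theta> (Eval \<sigma> x) \<alpha> z"
      unfolding fires_def step_Eval_iff by blast
  qed (simp add: fires_def step_Eval_iff, use sat_csubst[of \<sigma>] lvars in blast)
qed

section \<open>Bisimilarity, valuation by valuation\<close>

text \<open>The bridge between covers and valuations. \<open>T\<close> stands for being the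
  condition of a matching transition or termination, so that all clauses of a bisimulation are
  instances.\<close>

lemma covered_iff_pointwise:
  assumes "finite {\<psi>. T \<psi>}" "\<And>\<psi>. T \<psi> \<Longrightarrow> closed_cond \<DD> \<psi>"
  shows "(\<exists>\<Psi>. finite \<Psi> \<and> \<Psi> \<subseteq> Cs \<DD> \<and> valid \<DD> (CImp \<phi> (big_disj \<Psi>)) \<and> (\<forall>\<psi>\<in>\<Psi>. T \<psi>)) \<longleftrightarrow>
    (\<forall>\<rho> \<theta>. valuations \<DD> \<rho> \<theta> \<longrightarrow> sat \<DD> \<rho> \<theta> \<phi> \<longrightarrow> (\<exists>\<psi>. T \<psi> \<and> sat \<DD> \<rho> \<theta> \<psi>))"
    (is "?covered \<longleftrightarrow> ?pointwise")
proof
  assume ?covered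
  then obtain \<Psi> where \<Psi>: "finite \<Psi>" "valid \<DD> (CImp \<phi> (big_disj \<Psi>))" "\<forall>\<psi>\<in>\<Psi>. T \<psi>"
    by blast
  then show ?pointwise
    unfolding valid_iff sat.simps sat_big_disj[OF \<Psi>(1)] by blast
next
  assume pointwise: ?pointwise
  \<comment> \<open>The largest candidate for a cover. Intersecting with \<open>Cs\<close> loses
    nothing, because any closed condition that holds at some valuation is already there.\<close>
  let ?\<Psi> = "{\<psi>. T \<psi>} \<inter> Cs \<DD>"
  have "finite ?\<Psi>"
    using assms(1) by simp
  moreover have "valid \<DD> (CImp \<phi> (big_disj ?\<Psi>))"
    unfolding valid_iff sat.simps sat_big_disj[OF \<open>finite ?\<Psi>\<close>]
    using pointwise assms(2) in_Cs_if_sat by blast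
  ultimately show ?covered
    by (intro exI[of _ ?\<Psi>]) auto
qed

text \<open>Only one direction, so that both halves of a bisimulation are instances, for
  \<open>R\<close> and for its converse. The valuation is chosen afresh at each related pair and is
  not carried along transitions.\<close>

definition simulation ::
  "('s, 'f, 'u) data_algebra \<Rightarrow> ('a option \<Rightarrow> 'a option \<Rightarrow> 'a option) \<Rightarrow>
   (('a, 'f, 'v) proc \<Rightarrow> ('a, 'f, 'v) proc \<Rightarrow> bool) \<Rightarrow> bool" where
  "simulation \<DD> \<gamma> R \<longleftrightarrow>
     (\<forall>p q \<rho> \<theta>. R p q \<longrightarrow> valuations \<DD> \<rho> \<theta> \<longrightarrow>
        (halts \<DD> \<rho> \<theta> p \<longrightarrow> halts \<DD> \<rho> \<theta> q) \<and>
        (\<forall>\<alpha> p'. fires \<DD> \<gamma> \<rho> \<theta> p \<alpha> p' \<longrightarrow>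
           (\<exists>\<alpha>' q'. data_equiv \<DD> \<alpha> \<alpha>' \<and> fires \<DD> \<gamma> \<rho> \<theta> q \<alpha>' q' \<and> R p' q')))"

lemma covered_steps_iff:
  "(\<exists>\<Psi>. finite \<Psi> \<and> \<Psi> \<subseteq> Cs \<DD> \<and> valid \<DD> (CImp \<phi> (big_disj \<Psi>)) \<and>
      (\<forall>\<psi>\<in>\<Psi>. \<exists>\<alpha>' q'. data_equiv \<DD> \<alpha> \<alpha>' \<and> step \<DD> \<gamma> q \<psi> \<alpha>' q' \<and> Q q')) \<longleftrightarrow>
    (\<forall>\<rho> \<theta>. valuations \<DD> \<rho> \<theta> \<longrightarrow> sat \<DD> \<rho> \<theta> \<phi> \<longrightarrow>
      (\<exists>\<alpha>' q'. data_equiv \<DD> \<alpha> \<alpha>' \<and> fires \<DD> \<gamma> \<rho> \<theta> q \<alpha>' q' \<and> Q q'))"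
proof -
  let ?T = "\<lambda>\<psi>. \<exists>\<alpha>' q'. data_equiv \<DD> \<alpha> \<alpha>' \<and> step \<DD> \<gamma> q \<psi> \<alpha>' q' \<and> Q q'"
  \<comment> \<open>These conditions are first components of transitions of \<open>q\<close>, of
    which there are finitely many.\<close>
  have "finite {\<psi>. ?T \<psi>}"
    by (rule finite_subset[OF _ finite_imageI[OF finite_steps[of \<DD> \<gamma> q], of fst]]) force
  then show ?thesis
    by (subst covered_iff_pointwise[of ?T]) (auto simp: fires_def step_closed_cond, blast+)
qed

lemma covered_terminations_iff:
  "(\<exists>\<Psi>. finite \<Psi> \<and> \<Psi> \<subseteq> Cs \<DD> \<and> valid \<DD> (CImp \<phi> (big_disj \<Psi>)) \<and> (\<forall>\<psi>\<in>\<Psi>. terminates \<DD> q \<psi>)) \<longleftrightarrow>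
    (\<forall>\<rho> \<theta>. valuations \<DD> \<rho> \<theta> \<longrightarrow> sat \<DD> \<rho> \<theta> \<phi> \<longrightarrow> halts \<DD> \<rho> \<theta> q)"
  unfolding halts_def
  by (rule covered_iff_pointwise) (auto simp: finite_terminates terminates_closed_cond)

lemma bisimulation_iff_simulation:
  "bisimulation \<DD> \<gamma> R \<longleftrightarrow>
    R \<subseteq> Collect (proc_state \<DD>) \<times> Collect (proc_state \<DD>) \<and>
    simulation \<DD> \<gamma> (\<lambda>p q. (p, q) \<in> R) \<and> simulation \<DD> \<gamma> (\<lambda>p q. (q, p) \<in> R)"
  unfolding bisimulation_def covered_steps_iff covered_terminations_iff simulation_def
  by (fastforce simp: fires_def halts_def)

section \<open>Basic properties of bisimilarity, and coinduction\<close>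

lemma bisimilar_proc_state:
  assumes "bisimilar \<DD> \<gamma> p q"
  shows "proc_state \<DD> p" "proc_state \<DD> q"
  using assms by (auto simp: bisimilar_def bisimulation_def)

lemma bisimilar_sym:
  assumes "bisimilar \<DD> \<gamma> p q"
  shows "bisimilar \<DD> \<gamma> q p"
proof -
  from assms obtain R where "bisimulation \<DD> \<gamma> R" "(p, q) \<in> R"
    by (auto simp: bisimilar_def)
  then have "bisimulation \<DD> \<gamma> (R\<inverse>)" "(q, p) \<in> R\<inverse>"
    by (auto simp: bisimulation_iff_simulation)
  then show ?thesis
    unfolding bisimilar_def by blast
qed

lemma bisimilar_halts:
  assumes "bisimilar \<DD> \<gamma> p q" "valuations \<DD> \<rho> \<theta>" "halts \<DD> \<rho> \<theta> p"
  shows "halts \<DD> \<rho> \<theta> q"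
proof -
  from assms(1) obtain R where "bisimulation \<DD> \<gamma> R" "(p, q) \<in> R"
    by (auto simp: bisimilar_def)
  with assms(2,3) show ?thesis
    unfolding bisimulation_iff_simulation simulation_def by blast
qed

lemma bisimilar_fires:
  assumes "bisimilar \<DD> \<gamma> p q" "valuations \<DD> \<rho> \<theta>" "fires \<DD> \<gamma> \<rho> \<theta> p \<alpha> p'"
  obtains \<alpha>' q' where "data_equiv \<DD> \<alpha> \<alpha>'" "fires \<DD> \<gamma> \<rho> \<theta> q \<alpha>' q'" "bisimilar \<DD> \<gamma> p' q'"
proof -
  from assms(1) obtain R where R: "bisimulation \<DD> \<gamma> R" "(p, q) \<in> R"
    by (auto simp: bisimilar_def)
  with assms(2,3) obtain \<alpha>' q' where "data_equiv \<DD> \<alpha> \<alpha>'" "fires \<DD> \<gamma> \<rho> \<theta> q \<alpha>' q'" "(p', q') \<in> R"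
    unfolding bisimulation_iff_simulation simulation_def by blast
  with R that show ?thesis
    unfolding bisimilar_def by blast
qed

text \<open>Coinduction up to bisimilarity: targets may leave \<open>R\<close> for a pair already
  known to be bisimilar, as happens when a step makes an operator disappear. Symmetry of
  \<open>R\<close> reduces the work to one direction and one side.\<close>

lemma bisimilar_coinduct [consumes 1, case_names sym state halts fires]:
  assumes "R p q"
    and sym: "\<And>p q. R p q \<Longrightarrow> R q p"
    and state: "\<And>p q. R p q \<Longrightarrow> proc_state \<DD> p"
    and halts: "\<And>p q \<rho> \<theta>. R p q \<Longrightarrow> valuations \<DD> \<rho> \<theta> \<Longrightarrow> halts \<DD> \<rho> \<theta> p \<Longrightarrow> halts \<DD> \<rho> \<theta> q"
    and fires: "\<And>p q \<rho> \<theta> \<alpha> p'. R p q \<Longrightarrow> valuations \<DD> \<rho> \<theta> \<Longrightarrow> fires \<DD> \<gamma> \<rho> \<theta> p \<alpha> p' \<Longrightarrow>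
      \<exists>\<alpha>' q'. data_equiv \<DD> \<alpha> \<alpha>' \<and> fires \<DD> \<gamma> \<rho> \<theta> q \<alpha>' q' \<and> (R p' q' \<or> bisimilar \<DD> \<gamma> p' q')"
  shows "bisimilar \<DD> \<gamma> p q"
proof -
  let ?R = "\<lambda>p q. R p q \<or> bisimilar \<DD> \<gamma> p q"
  have "simulation \<DD> \<gamma> ?R"
    unfolding simulation_def
  proof (intro allI impI conjI)
    fix p q \<rho> \<theta>
    assume "?R p q" "valuations \<DD> \<rho> \<theta>" "halts \<DD> \<rho> \<theta> p"
    then show "halts \<DD> \<rho> \<theta> q"
      using halts bisimilar_halts by blast
  next
    fix p q \<rho> \<theta> \<alpha> p'
    assume "?R p q" and *: "valuations \<DD> \<rho> \<theta>" "fires \<DD> \<gamma> \<rho> \<theta> p \<alpha> p'"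
    from this(1) show "\<exists>\<alpha>' q'. data_equiv \<DD> \<alpha> \<alpha>' \<and> fires \<DD> \<gamma> \<rho> \<theta> q \<alpha>' q' \<and> ?R p' q'"
    proof
      assume "R p q"
      then show ?thesis using * by (rule fires)
    next
      assume "bisimilar \<DD> \<gamma> p q"
      then show ?thesis using * by (rule bisimilar_fires) blast
    qed
  qed
  \<comment> \<open>The union of two symmetric relations is its own converse, so the second
    simulation coincides with the first.\<close>
  moreover have "?R p q \<longleftrightarrow> ?R q p" for p q
    using sym bisimilar_sym by blast
  then have "simulation \<DD> \<gamma> (\<lambda>p q. ?R q p) \<longleftrightarrow> simulation \<DD> \<gamma> ?R"
    by presburger
  moreover have "{(p, q). ?R p q} \<subseteq> Collect (proc_state \<DD>) \<times> Collect (proc_state \<DD>)"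
    using state sym bisimilar_proc_state by blast
  ultimately have "bisimulation \<DD> \<gamma> {(p, q). ?R p q}"
    by (simp add: bisimulation_iff_simulation)
  with assms(1) show ?thesis
    unfolding bisimilar_def by blast
qed

section \<open>Congruence\<close>

lemma data_equiv_iff:
  "data_equiv \<DD> \<alpha> \<alpha>' \<longleftrightarrow>
    (\<exists>a. \<alpha> = Basic a \<and> \<alpha>' = Basic a) \<or>
    (\<exists>a es es'. \<alpha> = Param a es \<and> \<alpha>' = Param a es' \<and> length es = length es' \<and>
      (\<forall>\<rho> \<theta>. valuations \<DD> \<rho> \<theta> \<longrightarrow> map (dval \<DD> \<rho> \<theta>) es = map (dval \<DD> \<rho> \<theta>) es')) \<or>
    (\<exists>v e e'. \<alpha> = Assign v e \<and> \<alpha>' = Assign v e' \<and> valid \<DD> (CEq e e'))"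
  by (auto simp: data_equiv.simps valid_iff sat_conj_eqs)

text \<open>Data equivalent labels have equal values at every valuation. Hence the parameter test
  for \<open>\<alpha>'\<close> and \<open>\<beta>'\<close> follows at the given valuation, while the
  resulting labels agree at all valuations, as data equivalence demands.\<close>

lemma communicates_data_equiv:
  assumes "communicates \<DD> \<gamma> \<rho> \<theta> \<alpha> \<beta> \<kappa>" "data_equiv \<DD> \<alpha> \<alpha>'" "data_equiv \<DD> \<beta> \<beta>'"
    "valuations \<DD> \<rho> \<theta>"
  obtains \<kappa>' where "communicates \<DD> \<gamma> \<rho> \<theta> \<alpha>' \<beta>' \<kappa>'" "data_equiv \<DD> \<kappa> \<kappa>'"
  using assms(1)
proof cases
  case (1 a b c)
  with assms(2,3) have "\<alpha>' = Basic a" "\<beta>' = Basic b"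
    by (auto simp: data_equiv_iff)
  with 1 that[of "Basic c"] show ?thesis
    by (auto simp: data_equiv_iff intro: communicates.intros)
next
  case (2 a b c es es')
  with assms(2,3) obtain fs fs' where *: "\<alpha>' = Param a fs" "\<beta>' = Param b fs'"
      "length es = length fs" "length es' = length fs'"
      "\<And>\<rho> \<theta>. valuations \<DD> \<rho> \<theta> \<Longrightarrow> map (dval \<DD> \<rho> \<theta>) es = map (dval \<DD> \<rho> \<theta>) fs"
      "\<And>\<rho> \<theta>. valuations \<DD> \<rho> \<theta> \<Longrightarrow> map (dval \<DD> \<rho> \<theta>) es' = map (dval \<DD> \<rho> \<theta>) fs'"
    by (auto simp: data_equiv_iff simp del: map_eq_conv)
  then have "communicates \<DD> \<gamma> \<rho> \<theta> \<alpha>' \<beta>' (Param c fs)"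
    using 2 assms(4) by (simp add: communicates.intros del: map_eq_conv)
  moreover have "data_equiv \<DD> \<kappa> (Param c fs)"
    using 2 * by (simp add: data_equiv_iff del: map_eq_conv)
  ultimately show ?thesis by (rule that)
qed

section \<open>The operators other than evaluation\<close>

lemma bisimilar_Alt:
  assumes "bisimilar \<DD> \<gamma> p p'" "bisimilar \<DD> \<gamma> q q'"
  shows "bisimilar \<DD> \<gamma> (Alt p q) (Alt p' q')"
proof -
  let ?R = "\<lambda>x x'. \<exists>p q p' q'. x = Alt p q \<and> x' = Alt p' q' \<and> bisimilar \<DD> \<gamma> p p' \<and> bisimilar \<DD> \<gamma> q q'"
  have "?R (Alt p q) (Alt p' q')"
    using assms by blast
  then show ?thesis
  proof (coinduct rule: bisimilar_coinduct)
    case (sym x x')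
    then show ?case using bisimilar_sym by blast
  next
    case (state x x')
    then show ?case using bisimilar_proc_state by fastforce
  next
    case (halts x x' \<rho> \<theta>)
    then show ?case by (auto simp: halts_Alt dest: bisimilar_halts)
  next
    case (fires x x' \<rho> \<theta> \<alpha> z)
    then obtain p q p' q' where x: "x = Alt p q" "x' = Alt p' q'"
      and pq: "bisimilar \<DD> \<gamma> p p'" "bisimilar \<DD> \<gamma> q q'"
      by blast
    from fires(3) consider "fires \<DD> \<gamma> \<rho> \<theta> p \<alpha> z" | "fires \<DD> \<gamma> \<rho> \<theta> q \<alpha> z"
      by (auto simp: x fires_Alt)
    then show ?case
    proof cases
      case 1
      from pq(1) fires(2) 1 show ?thesis
        by (rule bisimilar_fires) (auto simp: x fires_Alt)
    next
      case 2
      from pq(2) fires(2) 2 show ?thesis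
        by (rule bisimilar_fires) (auto simp: x fires_Alt)
    qed
  qed
qed

lemma bisimilar_Seq:
  assumes "bisimilar \<DD> \<gamma> p p'" "bisimilar \<DD> \<gamma> q q'"
  shows "bisimilar \<DD> \<gamma> (Seq p q) (Seq p' q')"
proof -
  let ?R = "\<lambda>x x'. \<exists>p q p' q'. x = Seq p q \<and> x' = Seq p' q' \<and> bisimilar \<DD> \<gamma> p p' \<and> bisimilar \<DD> \<gamma> q q'"
  have "?R (Seq p q) (Seq p' q')"
    using assms by blast
  then show ?thesis
  proof (coinduct rule: bisimilar_coinduct)
    case (sym x x')
    then show ?case using bisimilar_sym by blast
  next
    case (state x x')
    then show ?case using bisimilar_proc_state by fastforce
  next
    case (halts x x' \<rho> \<theta>)
    then show ?case by (auto simp: halts_Seq dest: bisimilar_halts)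
  next
    case (fires x x' \<rho> \<theta> \<alpha> z)
    then obtain p q p' q' where x: "x = Seq p q" "x' = Seq p' q'"
      and pq: "bisimilar \<DD> \<gamma> p p'" "bisimilar \<DD> \<gamma> q q'"
      by blast
    from fires(2,3) consider "halts \<DD> \<rho> \<theta> p" "fires \<DD> \<gamma> \<rho> \<theta> q \<alpha> z"
      | u where "fires \<DD> \<gamma> \<rho> \<theta> p \<alpha> u" "z = Seq u q"
      by (auto simp: x fires_Seq)
    then show ?case
    proof cases
      case 1
      \<comment> \<open>The conditions under which \<open>p\<close> and \<open>p'\<close> terminate
        may differ; only their truth at the current valuation matters.\<close>
      then have "halts \<DD> \<rho> \<theta> p'"
        using pq(1) fires(2) by (blast intro: bisimilar_halts)
      moreover from pq(2) fires(2) 1(2) obtain \<alpha>' z' where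
        "data_equiv \<DD> \<alpha> \<alpha>'" "fires \<DD> \<gamma> \<rho> \<theta> q' \<alpha>' z'" "bisimilar \<DD> \<gamma> z z'"
        by (rule bisimilar_fires)
      ultimately show ?thesis
        using fires(2) by (intro exI[of _ \<alpha>'] exI[of _ z']) (simp add: x fires_Seq)
    next
      case 2
      from pq(1) fires(2) 2(1) obtain \<alpha>' u' where
        "data_equiv \<DD> \<alpha> \<alpha>'" "fires \<DD> \<gamma> \<rho> \<theta> p' \<alpha>' u'" "bisimilar \<DD> \<gamma> u u'"
        by (rule bisimilar_fires)
      with 2 pq fires(2) show ?thesis
        by (intro exI[of _ \<alpha>'] exI[of _ "Seq u' q'"]) (auto simp: x fires_Seq)
    qed
  qed
qed

text \<open>A step of the iterated process leads to \<open>Seq u (Iter p q)\<close>. Appealing to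
  \<open>bisimilar_Seq\<close> there would presuppose bisimilarity of the two iterations, which is
  the goal; so the candidate relation itself has to be closed under prefixing bisimilar
  processes.\<close>

inductive iter_unfolding ::
  "('s, 'f, 'u) data_algebra \<Rightarrow> ('a option \<Rightarrow> 'a option \<Rightarrow> 'a option) \<Rightarrow>
   ('a, 'f, 'v) proc \<Rightarrow> ('a, 'f, 'v) proc \<Rightarrow> bool"
  for \<DD> :: "('s, 'f, 'u) data_algebra" and \<gamma> where
  Iter: "bisimilar \<DD> \<gamma> p p' \<Longrightarrow> bisimilar \<DD> \<gamma> q q' \<Longrightarrow> iter_unfolding \<DD> \<gamma> (Iter p q) (Iter p' q')"
| Seq: "bisimilar \<DD> \<gamma> u u' \<Longrightarrow> iter_unfolding \<DD> \<gamma> x x' \<Longrightarrow> iter_unfolding \<DD> \<gamma> (Seq u x) (Seq u' x')"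

text \<open>Induction on the relation is needed for \<open>Seq u x\<close>: if \<open>u\<close>
  halts, the transition is one of \<open>x\<close>, whose match is supplied by the induction
  hypothesis.\<close>

lemma iter_unfolding_fires:
  assumes "iter_unfolding \<DD> \<gamma> x x'" "valuations \<DD> \<rho> \<theta>" "fires \<DD> \<gamma> \<rho> \<theta> x \<alpha> z"
  shows "\<exists>\<alpha>' z'. data_equiv \<DD> \<alpha> \<alpha>' \<and> fires \<DD> \<gamma> \<rho> \<theta> x' \<alpha>' z' \<and>
    (iter_unfolding \<DD> \<gamma> z z' \<or> bisimilar \<DD> \<gamma> z z')"
  using assms(1,3)
proof (induction rule: iter_unfolding.induct)
  case (Iter p p' q q')
  from Iter.prems consider "fires \<DD> \<gamma> \<rho> \<theta> q \<alpha> z"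
    | u where "fires \<DD> \<gamma> \<rho> \<theta> p \<alpha> u" "z = Seq u (Iter p q)"
    by (auto simp: fires_Iter)
  then show ?case
  proof cases
    case 1
    from Iter.hyps(2) assms(2) 1 show ?thesis
      by (rule bisimilar_fires) (auto simp: fires_Iter)
  next
    case 2
    from Iter.hyps(1) assms(2) 2(1) obtain \<alpha>' u' where
      "data_equiv \<DD> \<alpha> \<alpha>'" "fires \<DD> \<gamma> \<rho> \<theta> p' \<alpha>' u'" "bisimilar \<DD> \<gamma> u u'"
      by (rule bisimilar_fires)
    with 2 Iter.hyps show ?thesis
      by (intro exI[of _ \<alpha>'] exI[of _ "Seq u' (Iter p' q')"])
        (auto simp: fires_Iter intro: iter_unfolding.intros)
  qed
next
  case (Seq u u' x x')
  from Seq.prems assms(2) consider "halts \<DD> \<rho> \<theta> u" "fires \<DD> \<gamma> \<rho> \<theta> x \<alpha> z"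
    | w where "fires \<DD> \<gamma> \<rho> \<theta> u \<alpha> w" "z = Seq w x"
    by (auto simp: fires_Seq)
  then show ?case
  proof cases
    case 1
    then have "halts \<DD> \<rho> \<theta> u'"
      using Seq.hyps(1) assms(2) by (blast intro: bisimilar_halts)
    with Seq.IH[OF 1(2)] assms(2) show ?thesis
      by (auto simp: fires_Seq)
  next
    case 2
    from Seq.hyps(1) assms(2) 2(1) obtain \<alpha>' w' where
      "data_equiv \<DD> \<alpha> \<alpha>'" "fires \<DD> \<gamma> \<rho> \<theta> u' \<alpha>' w'" "bisimilar \<DD> \<gamma> w w'"
      by (rule bisimilar_fires)
    with 2 Seq.hyps assms(2) show ?thesis
      by (intro exI[of _ \<alpha>'] exI[of _ "Seq w' x'"])
        (auto simp: fires_Seq intro: iter_unfolding.intros)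
  qed
qed

lemma bisimilar_Iter:
  assumes "bisimilar \<DD> \<gamma> p p'" "bisimilar \<DD> \<gamma> q q'"
  shows "bisimilar \<DD> \<gamma> (Iter p q) (Iter p' q')"
proof -
  have "iter_unfolding \<DD> \<gamma> (Iter p q) (Iter p' q')"
    using assms by (rule iter_unfolding.Iter)
  then show ?thesis
  proof (rule bisimilar_coinduct)
    show "iter_unfolding \<DD> \<gamma> y x" if "iter_unfolding \<DD> \<gamma> x y" for x y
      using that by induction (auto intro: iter_unfolding.intros bisimilar_sym)
    show "proc_state \<DD> x" if "iter_unfolding \<DD> \<gamma> x y" for x y
      using that by induction (auto dest: bisimilar_proc_state)
    show "halts \<DD> \<rho> \<theta> y" if "iter_unfolding \<DD> \<gamma> x y" "valuations \<DD> \<rho> \<theta>" "halts \<DD> \<rho> \<theta> x" for x y \<rho> \<theta>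
      using that by induction (auto simp: halts_Iter halts_Seq dest: bisimilar_halts)
  qed (rule iter_unfolding_fires)
qed

lemma bisimilar_Guard:
  assumes "bisimilar \<DD> \<gamma> p p'" "closed_cond \<DD> \<psi>"
  shows "bisimilar \<DD> \<gamma> (Guard \<psi> p) (Guard \<psi> p')"
proof -
  let ?R = "\<lambda>x x'. \<exists>p p'. x = Guard \<psi> p \<and> x' = Guard \<psi> p' \<and> bisimilar \<DD> \<gamma> p p'"
  have "?R (Guard \<psi> p) (Guard \<psi> p')"
    using assms by blast
  then show ?thesis
  proof (coinduct rule: bisimilar_coinduct)
    case (sym x x')
    then show ?case using bisimilar_sym by blast
  next
    case (state x x')
    then show ?case using bisimilar_proc_state assms(2) by fastforce
  next
    case (halts x x' \<rho> \<theta>)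
    then show ?case using assms(2) by (auto simp: halts_Guard dest: bisimilar_halts)
  next
    case (fires x x' \<rho> \<theta> \<alpha> z)
    then obtain p p' where x: "x = Guard \<psi> p" "x' = Guard \<psi> p'" and p: "bisimilar \<DD> \<gamma> p p'"
      by blast
    have "fires \<DD> \<gamma> \<rho> \<theta> p \<alpha> z" and sat: "sat \<DD> \<rho> \<theta> \<psi>"
      using fires(2,3) assms(2) by (auto simp: x fires_Guard)
    from p fires(2) this(1) obtain \<alpha>' z' where
      "data_equiv \<DD> \<alpha> \<alpha>'" "fires \<DD> \<gamma> \<rho> \<theta> p' \<alpha>' z'" "bisimilar \<DD> \<gamma> z z'"
      by (rule bisimilar_fires)
    with sat fires(2) assms(2) show ?case
      by (intro exI[of _ \<alpha>'] exI[of _ z']) (simp add: x fires_Guard)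
  qed
qed

text \<open>Shared by \<open>Par\<close> and \<open>CMerge\<close>. The targets are delivered as
  componentwise bisimilar pairs and not as bisimilar \<open>Par\<close> terms, because the
  congruence of \<open>Par\<close> is itself derived from this.\<close>

lemma bisimilar_fires_CMerge:
  assumes "bisimilar \<DD> \<gamma> p p'" "bisimilar \<DD> \<gamma> q q'" "valuations \<DD> \<rho> \<theta>"
    and "fires \<DD> \<gamma> \<rho> \<theta> (CMerge p q) \<kappa> z"
  obtains \<kappa>' u v u' v' where "data_equiv \<DD> \<kappa> \<kappa>'" "fires \<DD> \<gamma> \<rho> \<theta> (CMerge p' q') \<kappa>' (Par u' v')"
    "z = Par u v" "bisimilar \<DD> \<gamma> u u'" "bisimilar \<DD> \<gamma> v v'"
proof -
  have states: "proc_state \<DD> p" "proc_state \<DD> q" "proc_state \<DD> p'" "proc_state \<DD> q'"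
    using assms(1,2) bisimilar_proc_state by blast+
  with assms(3,4) obtain \<alpha> \<beta> u v where
    uv: "fires \<DD> \<gamma> \<rho> \<theta> p \<alpha> u" "fires \<DD> \<gamma> \<rho> \<theta> q \<beta> v" "communicates \<DD> \<gamma> \<rho> \<theta> \<alpha> \<beta> \<kappa>" "z = Par u v"
    by (auto simp: fires_CMerge)
  obtain \<alpha>' u' where u': "data_equiv \<DD> \<alpha> \<alpha>'" "fires \<DD> \<gamma> \<rho> \<theta> p' \<alpha>' u'" "bisimilar \<DD> \<gamma> u u'"
    using assms(1,3) uv(1) by (rule bisimilar_fires)
  obtain \<beta>' v' where v': "data_equiv \<DD> \<beta> \<beta>'" "fires \<DD> \<gamma> \<rho> \<theta> q' \<beta>' v'" "bisimilar \<DD> \<gamma> v v'"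
    using assms(2,3) uv(2) by (rule bisimilar_fires)
  obtain \<kappa>' where \<kappa>': "communicates \<DD> \<gamma> \<rho> \<theta> \<alpha>' \<beta>' \<kappa>'" "data_equiv \<DD> \<kappa> \<kappa>'"
    using uv(3) u'(1) v'(1) assms(3) by (rule communicates_data_equiv)
  then have "fires \<DD> \<gamma> \<rho> \<theta> (CMerge p' q') \<kappa>' (Par u' v')"
    using u' v' states assms(3) by (auto simp: fires_CMerge)
  with \<kappa>'(2) uv(4) u'(3) v'(3) that show ?thesis by blast
qed

lemma bisimilar_Par:
  assumes "bisimilar \<DD> \<gamma> p p'" "bisimilar \<DD> \<gamma> q q'"
  shows "bisimilar \<DD> \<gamma> (Par p q) (Par p' q')"
proof -
  let ?R = "\<lambda>x x'. \<exists>p q p' q'. x = Par p q \<and> x' = Par p' q' \<and> bisimilar \<DD> \<gamma> p p' \<and> bisimilar \<DD> \<gamma> q q'"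
  have "?R (Par p q) (Par p' q')"
    using assms by blast
  then show ?thesis
  proof (coinduct rule: bisimilar_coinduct)
    case (sym x x')
    then show ?case using bisimilar_sym by blast
  next
    case (state x x')
    then show ?case using bisimilar_proc_state by fastforce
  next
    case (halts x x' \<rho> \<theta>)
    then show ?case by (auto simp: halts_Par dest: bisimilar_halts)
  next
    case (fires x x' \<rho> \<theta> \<alpha> z)
    then obtain p q p' q' where x: "x = Par p q" "x' = Par p' q'"
      and pq: "bisimilar \<DD> \<gamma> p p'" "bisimilar \<DD> \<gamma> q q'"
      by blast
    from fires(3) consider u where "fires \<DD> \<gamma> \<rho> \<theta> p \<alpha> u" "z = Par u q"
      | v where "fires \<DD> \<gamma> \<rho> \<theta> q \<alpha> v" "z = Par p v" | "fires \<DD> \<gamma> \<rho> \<theta> (CMerge p q) \<alpha> z"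
      by (auto simp: x fires_Par)
    then show ?case
    proof cases
      case 1
      from pq(1) fires(2) 1(1) obtain \<alpha>' u' where
        "data_equiv \<DD> \<alpha> \<alpha>'" "fires \<DD> \<gamma> \<rho> \<theta> p' \<alpha>' u'" "bisimilar \<DD> \<gamma> u u'"
        by (rule bisimilar_fires)
      with 1 pq show ?thesis
        by (intro exI[of _ \<alpha>'] exI[of _ "Par u' q'"]) (auto simp: x fires_Par)
    next
      case 2
      from pq(2) fires(2) 2(1) obtain \<alpha>' v' where
        "data_equiv \<DD> \<alpha> \<alpha>'" "fires \<DD> \<gamma> \<rho> \<theta> q' \<alpha>' v'" "bisimilar \<DD> \<gamma> v v'"
        by (rule bisimilar_fires)
      with 2 pq show ?thesis
        by (intro exI[of _ \<alpha>'] exI[of _ "Par p' v'"]) (auto simp: x fires_Par)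
    next
      case 3
      from pq fires(2) 3 show ?thesis
        by (rule bisimilar_fires_CMerge) (auto simp: x fires_Par)
    qed
  qed
qed

lemma bisimilar_LMerge:
  assumes "bisimilar \<DD> \<gamma> p p'" "bisimilar \<DD> \<gamma> q q'"
  shows "bisimilar \<DD> \<gamma> (LMerge p q) (LMerge p' q')"
proof -
  let ?R = "\<lambda>x x'. \<exists>p q p' q'. x = LMerge p q \<and> x' = LMerge p' q' \<and> bisimilar \<DD> \<gamma> p p' \<and> bisimilar \<DD> \<gamma> q q'"
  have "?R (LMerge p q) (LMerge p' q')"
    using assms by blast
  then show ?thesis
  proof (coinduct rule: bisimilar_coinduct)
    case (sym x x')
    then show ?case using bisimilar_sym by blast
  next
    case (state x x')
    then show ?case using bisimilar_proc_state by fastforce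
  next
    case (halts x x' \<rho> \<theta>)
    then show ?case by (auto simp: halts_LMerge)
  next
    case (fires x x' \<rho> \<theta> \<alpha> z)
    then obtain p q p' q' u where x: "x = LMerge p q" "x' = LMerge p' q'"
      and pq: "bisimilar \<DD> \<gamma> p p'" "bisimilar \<DD> \<gamma> q q'"
      and u: "fires \<DD> \<gamma> \<rho> \<theta> p \<alpha> u" "z = Par u q"
      by (auto simp: fires_LMerge)
    from pq(1) fires(2) u(1) obtain \<alpha>' u' where
      "data_equiv \<DD> \<alpha> \<alpha>'" "fires \<DD> \<gamma> \<rho> \<theta> p' \<alpha>' u'" "bisimilar \<DD> \<gamma> u u'"
      by (rule bisimilar_fires)
    \<comment> \<open>After one step the left merge has become a \<open>Par\<close>, so the targets
      leave \<open>?R\<close> and are bisimilar by \<open>bisimilar_Par\<close>.\<close>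
    with u pq show ?case
      by (intro exI[of _ \<alpha>'] exI[of _ "Par u' q'"]) (auto simp: x fires_LMerge bisimilar_Par)
  qed
qed

lemma bisimilar_CMerge:
  assumes "bisimilar \<DD> \<gamma> p p'" "bisimilar \<DD> \<gamma> q q'"
  shows "bisimilar \<DD> \<gamma> (CMerge p q) (CMerge p' q')"
proof -
  let ?R = "\<lambda>x x'. \<exists>p q p' q'. x = CMerge p q \<and> x' = CMerge p' q' \<and> bisimilar \<DD> \<gamma> p p' \<and> bisimilar \<DD> \<gamma> q q'"
  have "?R (CMerge p q) (CMerge p' q')"
    using assms by blast
  then show ?thesis
  proof (coinduct rule: bisimilar_coinduct)
    case (sym x x')
    then show ?case using bisimilar_sym by blast
  next
    case (state x x')
    then show ?case using bisimilar_proc_state by fastforce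
  next
    case (halts x x' \<rho> \<theta>)
    then show ?case by (auto simp: halts_CMerge)
  next
    case (fires x x' \<rho> \<theta> \<alpha> z)
    then obtain p q p' q' where x: "x = CMerge p q" "x' = CMerge p' q'"
      and pq: "bisimilar \<DD> \<gamma> p p'" "bisimilar \<DD> \<gamma> q q'"
      by blast
    from pq fires(2) fires(3)[unfolded x] obtain \<alpha>' u v u' v' where
      "data_equiv \<DD> \<alpha> \<alpha>'" "fires \<DD> \<gamma> \<rho> \<theta> (CMerge p' q') \<alpha>' (Par u' v')"
      "z = Par u v" "bisimilar \<DD> \<gamma> u u'" "bisimilar \<DD> \<gamma> v v'"
      by (rule bisimilar_fires_CMerge)
    then show ?case
      by (intro exI[of _ \<alpha>'] exI[of _ "Par u' v'"]) (simp add: x bisimilar_Par)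
  qed
qed

lemma bisimilar_Encap:
  assumes "bisimilar \<DD> \<gamma> p p'"
  shows "bisimilar \<DD> \<gamma> (Encap H p) (Encap H p')"
proof -
  let ?R = "\<lambda>x x'. \<exists>p p'. x = Encap H p \<and> x' = Encap H p' \<and> bisimilar \<DD> \<gamma> p p'"
  have "?R (Encap H p) (Encap H p')"
    using assms by blast
  then show ?thesis
  proof (coinduct rule: bisimilar_coinduct)
    case (sym x x')
    then show ?case using bisimilar_sym by blast
  next
    case (state x x')
    then show ?case using bisimilar_proc_state by fastforce
  next
    case (halts x x' \<rho> \<theta>)
    then show ?case by (auto simp: halts_Encap dest: bisimilar_halts)
  next
    case (fires x x' \<rho> \<theta> \<alpha> z)
    then obtain p p' u where x: "x = Encap H p" "x' = Encap H p'" and p: "bisimilar \<DD> \<gamma> p p'"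
      and u: "fires \<DD> \<gamma> \<rho> \<theta> p \<alpha> u" "unblocked H \<alpha>" "z = Encap H u"
      by (auto simp: fires_Encap)
    from p fires(2) u(1) obtain \<alpha>' u' where
      u': "data_equiv \<DD> \<alpha> \<alpha>'" "fires \<DD> \<gamma> \<rho> \<theta> p' \<alpha>' u'" "bisimilar \<DD> \<gamma> u u'"
      by (rule bisimilar_fires)
    \<comment> \<open>Encapsulation inspects only the kind and name of an action, which data
      equivalence preserves.\<close>
    then have "unblocked H \<alpha>'"
      using u(2) by (auto simp: data_equiv_iff)
    with u u' show ?case
      by (intro exI[of _ \<alpha>'] exI[of _ "Encap H u'"]) (auto simp: x fires_Encap)
  qed
qed

subsection \<open>Evaluation operators\<close>

text \<open>Agreement on the unevaluated variables does not follow from equality of values: over a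
  one-element data carrier every data term equals \<open>FVar v\<close>, yet an assignment to
  \<open>v\<close> updates only the maps that evaluate \<open>v\<close>.\<close>

definition eval_equiv ::
  "('s, 'f, 'u) data_algebra \<Rightarrow> ('v \<Rightarrow> ('f, 'v) dterm) \<Rightarrow> ('v \<Rightarrow> ('f, 'v) dterm) \<Rightarrow> bool" where
  "eval_equiv \<DD> \<sigma> \<tau> \<longleftrightarrow> ext_eval_map \<DD> \<sigma> \<and> ext_eval_map \<DD> \<tau> \<and>
     (\<forall>v. (\<sigma> v = FVar v \<longleftrightarrow> \<tau> v = FVar v) \<and> valid \<DD> (CEq (\<sigma> v) (\<tau> v)))"

lemma eval_equiv_dval:
  assumes "eval_equiv \<DD> \<sigma> \<tau>" "valuations \<DD> \<rho> \<theta>"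
  shows "dval \<DD> \<rho> \<theta> (\<sigma> v) = dval \<DD> \<rho> \<theta> (\<tau> v)"
  using assms by (auto simp: eval_equiv_def valid_iff)

lemma dval_in_carr:
  assumes "op_closed \<DD> (carr \<DD>)" "valuations \<DD> \<rho> \<theta>"
  shows "well_sorted \<DD> e \<Longrightarrow> dval \<DD> \<rho> \<theta> e \<in> carr \<DD> (sort_of \<DD> e)"
proof (induction e)
  case (Op f ts)
  then have "\<forall>t\<in>set ts. dval \<DD> \<rho> \<theta> t \<in> carr \<DD> (sort_of \<DD> t)"
    by (auto simp: list_all_iff)
  then have "list_all2 (\<lambda>u s. u \<in> carr \<DD> s) (map (dval \<DD> \<rho> \<theta>) ts) (map (sort_of \<DD>) ts)"
    by (auto simp: list_all2_conv_all_nth)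
  moreover have "map (sort_of \<DD>) ts = arg_sorts \<DD> f"
    using Op.prems by simp
  ultimately show ?case
    using assms(1) by (simp add: op_closed_def)
qed (use assms(2) in \<open>auto simp: valuations_def\<close>)

text \<open>Bisimilarity speaks only of valuations into the carrier, so it can be used at the
  valuation induced by \<open>\<sigma>\<close> only once that valuation is known to stay there. This
  rests on closure of the carriers under the operations.\<close>

lemma valuations_dval:
  assumes "op_closed \<DD> (carr \<DD>)" "valuations \<DD> \<rho> \<theta>" "ext_eval_map \<DD> \<sigma>"
  shows "valuations \<DD> (\<lambda>v. dval \<DD> \<rho> \<theta> (\<sigma> v)) \<theta>"
proof -
  have "dval \<DD> \<rho> \<theta> (\<sigma> v) \<in> carr \<DD> (dsort \<DD>)" for v
    using dval_in_carr[OF assms(1,2), of "\<sigma> v"] ext_eval_map_closed_data[OF assms(3), of v]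
    by (simp add: closed_data_def)
  with assms(2) show ?thesis
    by (auto simp: valuations_def)
qed

text \<open>Both maps induce the same valuation, and at this valuation \<open>e\<close> and
  \<open>e'\<close> have the same value.\<close>

lemma dval_dsubst_equiv:
  assumes "op_closed \<DD> (carr \<DD>)" "eval_equiv \<DD> \<sigma> \<tau>" "valuations \<DD> \<rho> \<theta>"
    and "\<And>\<rho> \<theta>. valuations \<DD> \<rho> \<theta> \<Longrightarrow> dval \<DD> \<rho> \<theta> e = dval \<DD> \<rho> \<theta> e'"
  shows "dval \<DD> \<rho> \<theta> (dsubst \<sigma> e) = dval \<DD> \<rho> \<theta> (dsubst \<tau> e')"
proof -
  have "ext_eval_map \<DD> \<tau>"
    using assms(2) by (simp add: eval_equiv_def)
  then show ?thesis
    using assms(4)[OF valuations_dval[OF assms(1,3)]] eval_equiv_dval[OF assms(2,3)]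
    by (simp add: dval_dsubst)
qed

lemma data_equiv_action_subst:
  assumes "op_closed \<DD> (carr \<DD>)" "eval_equiv \<DD> \<sigma> \<tau>" "data_equiv \<DD> \<alpha> \<alpha>'"
  shows "data_equiv \<DD> (action_subst \<sigma> \<alpha>) (action_subst \<tau> \<alpha>')"
  using assms(3)
proof cases
  case (1 a)
  then show ?thesis by (simp add: data_equiv_iff)
next
  case (2 es es' a)
  then have "dval \<DD> \<rho> \<theta> (es ! i) = dval \<DD> \<rho> \<theta> (es' ! i)"
    if "valuations \<DD> \<rho> \<theta>" "i < length es" for \<rho> \<theta> i
    using that by (auto simp: valid_iff sat_conj_eqs list_eq_iff_nth_eq)
  then have "dval \<DD> \<rho> \<theta> (dsubst \<sigma> (es ! i)) = dval \<DD> \<rho> \<theta> (dsubst \<tau> (es' ! i))"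
    if "valuations \<DD> \<rho> \<theta>" "i < length es" for \<rho> \<theta> i
    using that by (intro dval_dsubst_equiv assms)
  then have "map (dval \<DD> \<rho> \<theta>) (map (dsubst \<sigma>) es) = map (dval \<DD> \<rho> \<theta>) (map (dsubst \<tau>) es')"
    if "valuations \<DD> \<rho> \<theta>" for \<rho> \<theta>
    using that 2 by (auto simp: list_eq_iff_nth_eq)
  with 2 show ?thesis
    unfolding data_equiv_iff by (simp del: map_map)
next
  case (3 e e' v)
  then show ?thesis
    using dval_dsubst_equiv[OF assms(1,2), of _ _ e e'] by (simp add: data_equiv_iff valid_iff)
qed

text \<open>Flexible variables surviving in \<open>dsubst \<sigma> e\<close> are left unevaluated by
  \<open>\<sigma>\<close>, and \<open>v\<close> is not among those. So a variable once evaluated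
  stays evaluated after an update.\<close>

lemma dsubst_neq_FVar:
  assumes "ext_eval_map S \<sigma>" "closed_data S e" "\<sigma> v \<noteq> FVar v"
  shows "dsubst \<sigma> e \<noteq> FVar v"
  using closed_data_dsubst[OF assms(1,2)] assms(3) by auto

text \<open>The maps agree on whether \<open>v\<close> is evaluated, so both are updated or neither
  is. After an update the new entries have equal values, and neither is \<open>FVar v\<close>, so
  the agreement persists. Closed labels keep the updated maps within
  \<open>ext_eval_map\<close>.\<close>

lemma eval_equiv_update:
  assumes "op_closed \<DD> (carr \<DD>)" "eval_equiv \<DD> \<sigma> \<tau>" "data_equiv \<DD> \<alpha> \<alpha>'"
    and "closed_action \<DD> \<alpha>" "closed_action \<DD> \<alpha>'"
  shows "eval_equiv \<DD> (eval_update \<sigma> \<alpha>) (eval_update \<tau> \<alpha>')"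
  using assms(3)
proof cases
  case (3 e e' v)
  show ?thesis
  proof (cases "\<sigma> v = FVar v")
    case True
    then have "\<tau> v = FVar v"
      using assms(2) by (simp add: eval_equiv_def)
    with True 3 assms(2) show ?thesis by simp
  next
    case False
    have ext: "ext_eval_map \<DD> \<sigma>" "ext_eval_map \<DD> \<tau>" and neq: "\<tau> v \<noteq> FVar v"
      using assms(2) False by (auto simp: eval_equiv_def)
    have closed: "closed_data \<DD> e" "closed_data \<DD> e'"
      using assms(4,5) 3 by simp_all
    have "valid \<DD> (CEq (dsubst \<sigma> e) (dsubst \<tau> e'))"
      using dval_dsubst_equiv[OF assms(1,2), of _ _ e e'] 3 by (simp add: valid_iff)
    then show ?thesis
      using assms(2) False neq 3 ext_eval_map_update[OF ext(1) closed(1) False]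
        ext_eval_map_update[OF ext(2) closed(2) neq] dsubst_neq_FVar[OF ext(1) closed(1) False]
        dsubst_neq_FVar[OF ext(2) closed(2) neq]
      by (simp add: eval_equiv_def)
  qed
qed (use assms(2) in simp_all)

lemma eval_equiv_sym: "eval_equiv \<DD> \<sigma> \<tau> \<Longrightarrow> eval_equiv \<DD> \<tau> \<sigma>"
  by (auto simp: eval_equiv_def valid_iff)

lemma bisimilar_Eval:
  assumes "op_closed \<DD> (carr \<DD>)" "bisimilar \<DD> \<gamma> p p'" "eval_equiv \<DD> \<sigma> \<tau>"
  shows "bisimilar \<DD> \<gamma> (Eval \<sigma> p) (Eval \<tau> p')"
proof -
  let ?R = "\<lambda>x x'. \<exists>\<sigma> \<tau> p p'. x = Eval \<sigma> p \<and> x' = Eval \<tau> p' \<and> eval_equiv \<DD> \<sigma> \<tau> \<and> bisimilar \<DD> \<gamma> p p'"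
  have "?R (Eval \<sigma> p) (Eval \<tau> p')"
    using assms by blast
  then show ?thesis
  proof (coinduct rule: bisimilar_coinduct)
    case (sym x x')
    then show ?case using bisimilar_sym eval_equiv_sym by blast
  next
    case (state x x')
    then show ?case using bisimilar_proc_state by (fastforce simp: eval_equiv_def)
  next
    case (halts x x' \<rho> \<theta>)
    then obtain \<sigma> \<tau> p p' where x: "x = Eval \<sigma> p" "x' = Eval \<tau> p'"
      and equiv: "eval_equiv \<DD> \<sigma> \<tau>" and p: "bisimilar \<DD> \<gamma> p p'"
      by blast
    then have ext: "ext_eval_map \<DD> \<sigma>" "ext_eval_map \<DD> \<tau>"
      by (simp_all add: eval_equiv_def)
    \<comment> \<open>Bisimilarity of \<open>p\<close> and \<open>p'\<close> is applied at the
      valuation induced by \<open>\<sigma>\<close>, which is also the one induced by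
      \<open>\<tau>\<close>.\<close>
    have "halts \<DD> (\<lambda>v. dval \<DD> \<rho> \<theta> (\<sigma> v)) \<theta> p'"
      using bisimilar_halts[OF p valuations_dval[OF assms(1) halts(2) ext(1)]] halts(2,3) ext
      by (simp add: x halts_Eval)
    then show ?case
      using halts(2) ext eval_equiv_dval[OF equiv halts(2)] by (simp add: x halts_Eval)
  next
    case (fires x x' \<rho> \<theta> \<alpha> z)
    then obtain \<sigma> \<tau> p p' where x: "x = Eval \<sigma> p" "x' = Eval \<tau> p'"
      and equiv: "eval_equiv \<DD> \<sigma> \<tau>" and p: "bisimilar \<DD> \<gamma> p p'"
      by blast
    then have ext: "ext_eval_map \<DD> \<sigma>" "ext_eval_map \<DD> \<tau>"
      by (simp_all add: eval_equiv_def)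
    from fires(2,3) ext obtain \<beta> u where
      u: "fires \<DD> \<gamma> (\<lambda>v. dval \<DD> \<rho> \<theta> (\<sigma> v)) \<theta> p \<beta> u"
        "\<alpha> = action_subst \<sigma> \<beta>" "z = Eval (eval_update \<sigma> \<beta>) u"
      by (auto simp: x fires_Eval)
    from p valuations_dval[OF assms(1) fires(2) ext(1)] u(1) obtain \<beta>' u' where
      u': "data_equiv \<DD> \<beta> \<beta>'" "fires \<DD> \<gamma> (\<lambda>v. dval \<DD> \<rho> \<theta> (\<sigma> v)) \<theta> p' \<beta>' u'" "bisimilar \<DD> \<gamma> u u'"
      by (rule bisimilar_fires)
    \<comment> \<open>The match was found at the valuation induced by \<open>\<sigma>\<close>; since
      \<open>\<tau>\<close> induces the same one, it lifts to a transition of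
      \<open>Eval \<tau> p'\<close>.\<close>
    then have "fires \<DD> \<gamma> \<rho> \<theta> x' (action_subst \<tau> \<beta>') (Eval (eval_update \<tau> \<beta>') u')"
      using fires(2) ext eval_equiv_dval[OF equiv fires(2)] by (auto simp: x fires_Eval)
    moreover have "data_equiv \<DD> \<alpha> (action_subst \<tau> \<beta>')"
      using assms(1) equiv u'(1) unfolding u(2) by (rule data_equiv_action_subst)
    moreover have "eval_equiv \<DD> (eval_update \<sigma> \<beta>) (eval_update \<tau> \<beta>')"
      using assms(1) equiv u'(1) fires_proc_state(1)[OF u(1)] fires_proc_state(1)[OF u'(2)]
        bisimilar_proc_state[OF p]
      by (blast intro: eval_equiv_update)
    ultimately show ?case
      using u(3) u'(3) by blast
  qed
qed

theorem theorem1: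
  fixes \<DD> :: "('s, 'f, 'u) data_algebra"
    and \<gamma> :: "'a::finite option \<Rightarrow> 'a option \<Rightarrow> 'a option"
    and p q p' q' :: "('a, 'f, 'v::countable) proc"
    and \<phi> :: "('f, 'v) cond"
    and H :: "'a set"
    and \<sigma> :: "'v \<Rightarrow> ('f, 'v) dterm"
  assumes "infinite (UNIV :: 'v set)"
    and "minimal_algebra \<DD>"
    and "communication_function \<gamma>"
    and "closed_proc \<DD> p" and "closed_proc \<DD> q" and "closed_proc \<DD> p'" and "closed_proc \<DD> q'"
    and "closed_cond \<DD> \<phi>"
    and "eval_map \<DD> \<sigma>"
    and "bisimilar \<DD> \<gamma> p p'" and "bisimilar \<DD> \<gamma> q q'"
  shows "bisimilar \<DD> \<gamma> (Alt p q) (Alt p' q') \<and>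
    bisimilar \<DD> \<gamma> (Seq p q) (Seq p' q') \<and>
    bisimilar \<DD> \<gamma> (Iter p q) (Iter p' q') \<and>
    bisimilar \<DD> \<gamma> (Guard \<phi> p) (Guard \<phi> p') \<and>
    bisimilar \<DD> \<gamma> (Par p q) (Par p' q') \<and>
    bisimilar \<DD> \<gamma> (LMerge p q) (LMerge p' q') \<and>
    bisimilar \<DD> \<gamma> (CMerge p q) (CMerge p' q') \<and>
    bisimilar \<DD> \<gamma> (Encap H p) (Encap H p') \<and>
    bisimilar \<DD> \<gamma> (Eval \<sigma> p) (Eval \<sigma> p')"
proof -
  have closed: "op_closed \<DD> (carr \<DD>)"
    using assms(2) by (simp add: minimal_algebra_def)
  have "eval_equiv \<DD> \<sigma> \<sigma>"
    using assms(9) by (simp add: eval_equiv_def valid_iff eval_map_imp_ext_eval_map)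
  with assms(8,10,11) closed show ?thesis
    by (simp add: bisimilar_Alt bisimilar_Seq bisimilar_Iter bisimilar_Guard bisimilar_Par
        bisimilar_LMerge bisimilar_CMerge bisimilar_Encap bisimilar_Eval)
qed

end
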